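(* Let $V:S^1\to\mathbb{R}$ be of class $C^{k-1,1}(S^1)$ for some $k\ge2$ with $\kappa'(\theta)>0$ for all $\theta$. For each $n$, let $\gamma_{n-1}>0$ be the leading coefficient of the orthonormal polynomial of degree $n-1$ with respect to the weight $\phi(\theta)=e^{-nV(\theta)}$ on the unit circle, and let $V_0=\frac{1}{2\pi}\int_{-\pi}^\pi V(\theta)d\theta$. Then there is a constant $K>0$ such that \[ \left|\gamma_{n-1}^2e^{-nV_0}-1\right|\le\frac{K\log(n)}{n^{2(k-1)}} \] for all sufficiently large $n$.
   Context: $C^{k-1,1}(S^1)$: functions on the circle whose periodic extension has $k-1$ Lipschitz continuous derivatives. For the fixed weight $\phi=e^{-nV}$, orthonormal polynomials $p_j(z)=\gamma_jz^j+\dots$ with $\gamma_j>0$ satisfy $\langle p_i,p_j\rangle_\phi=\delta_{ij}$, where $\langle f,g\rangle_\phi=\frac{1}{2\pi}\int_{-\pi}^{\pi}f(e^{i\theta})\overline{g(e^{i\theta})}\phi(\theta)d\theta$. $V_j$ the Fourier coefficients of $V$, $N(z)=\sum_{j\ge1}V_{-j}z^{-j}$, $\Omega(\theta)=2\,\mathrm{Im}\,N(e^{i\theta})$, $\kappa(\theta)=\theta+\Omega(\theta)$. *)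

theory Defs
  imports "HOL-Analysis.Analysis" "HOL-Computational_Algebra.Polynomial"
begin

text \<open>Functions on the circle are represented as 2pi-periodic functions on the reals.\<close>

definition periodic_2pi :: "(real \<Rightarrow> 'a) \<Rightarrow> bool" where
  "periodic_2pi f \<longleftrightarrow> (\<forall>\<theta>. f (\<theta> + 2 * pi) = f \<theta>)"

definition C_lip_circle :: "nat \<Rightarrow> (real \<Rightarrow> real) \<Rightarrow> bool" where
  "C_lip_circle m V \<longleftrightarrow> periodic_2pi V \<and>
     (\<forall>j<m. \<forall>x. ((deriv ^^ j) V) differentiable (at x)) \<and>
     (\<exists>L. L-lipschitz_on UNIV ((deriv ^^ m) V))"

definition fourier_coeff :: "(real \<Rightarrow> real) \<Rightarrow> int \<Rightarrow> complex" where
  "fourier_coeff V j = integral {-pi..pi}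
      (\<lambda>\<theta>. complex_of_real (V \<theta>) * exp (- \<i> * of_int j * of_real \<theta>)) / complex_of_real (2 * pi)"

definition N_fun :: "(real \<Rightarrow> real) \<Rightarrow> complex \<Rightarrow> complex" where
  "N_fun V z = (\<Sum>j. fourier_coeff V (- int (Suc j)) * z powi (- int (Suc j)))"

definition Omega :: "(real \<Rightarrow> real) \<Rightarrow> real \<Rightarrow> real" where
  "Omega V \<theta> = 2 * Im (N_fun V (exp (\<i> * of_real \<theta>)))"

definition kappa :: "(real \<Rightarrow> real) \<Rightarrow> real \<Rightarrow> real" where
  "kappa V \<theta> = \<theta> + Omega V \<theta>"

definition inner_w :: "(real \<Rightarrow> real) \<Rightarrow> complex poly \<Rightarrow> complex poly \<Rightarrow> complex" where
  "inner_w \<phi> f g = integral {-pi..pi}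
      (\<lambda>\<theta>. poly f (exp (\<i> * of_real \<theta>)) * cnj (poly g (exp (\<i> * of_real \<theta>)))
            * complex_of_real (\<phi> \<theta>)) / complex_of_real (2 * pi)"

definition orthonormal_polys :: "(real \<Rightarrow> real) \<Rightarrow> (nat \<Rightarrow> complex poly) \<Rightarrow> bool" where
  "orthonormal_polys \<phi> p \<longleftrightarrow>
     (\<forall>j. degree (p j) = j \<and> Im (lead_coeff (p j)) = 0 \<and> Re (lead_coeff (p j)) > 0) \<and>
     (\<forall>i j. inner_w \<phi> (p i) (p j) = (if i = j then 1 else 0))"

end

theory Submission
  imports Defs "HOL-Complex_Analysis.Complex_Analysis"
begin

text \<open>
  Write \<open>V = V\<^sub>0 + A + cnj A\<close> on the circle, with \<open>A(z) = \<Sum>j\<ge>1. V\<^sub>j z^j\<close>, and put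
  \<open>g = exp (-nA)\<close>, so that the weight is \<open>exp (-nV\<^sub>0) |g|\<^sup>2\<close> and \<open>\<kappa> = \<theta> - 2 Im A\<close>.
  If \<open>q\<close> is the reversed orthonormal polynomial of degree \<open>n - 1\<close>, then
  \<open>f = 1 - \<gamma> exp (-nV\<^sub>0) q g\<close> is \<open>1\<close> minus its orthogonal projection onto
  the span of \<open>g, zg, \<dots>, z^(n-1) g\<close>. Hence the squared \<open>L\<^sup>2\<close> norm of \<open>f\<close> equals both the mean of
  \<open>f\<close> and \<open>1 - \<gamma>\<^sup>2 exp (-nV\<^sub>0)\<close>. The Fourier coefficients \<open>0, \<dots>, n-1\<close> of \<open>f cnj g\<close> vanish,
  so \<open>f = cnj a + exp (in\<kappa>) b\<close> with \<open>a, b\<close> analytic in the disc and \<open>a(0) = 0\<close>. Only the part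
  \<open>R\<close> of \<open>exp (in\<kappa>)\<close> with frequencies \<open>\<le> 0\<close> contributes to the mean of \<open>f\<close> and to the cross term of
  its norm, which gives \<open>1 - \<gamma>\<^sup>2 exp (-nV\<^sub>0) \<le> 2 mean |R|\<^sup>2\<close> as soon as \<open>|R| \<le> 1/2\<close>.

  Since \<open>\<kappa>' > 0\<close>, shifting the contour into the upper half plane makes these frequencies small.
  To do this for a nonanalytic \<open>\<kappa>\<close>, telescope over the dyadic Fourier truncations \<open>\<kappa>\<^sub>N\<close>:
  the difference of \<open>exp (in\<kappa>)\<close> at levels \<open>2N\<close> and \<open>N\<close> can be shifted by a multiple of \<open>1/N\<close>,
  and there has \<open>L\<^sup>2\<close> norm at most a constant times \<open>n N^(-k) exp (-cn/N)\<close>, because \<open>V\<close> has \<open>k\<close> derivatives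
  in \<open>L\<^sup>2\<close>. The sum over \<open>N = 2^l\<close> is dominated by \<open>N\<close> of order \<open>n\<close> and is of order \<open>n^(1-k)\<close>.
\<close>

section \<open>Means over the circle\<close>

definition mean :: "(real \<Rightarrow> 'a::banach) \<Rightarrow> 'a" where
  "mean f = (1 / (2 * pi)) *\<^sub>R integral {-pi..pi} f"

definition fcoeff :: "(real \<Rightarrow> complex) \<Rightarrow> int \<Rightarrow> complex" where
  "fcoeff f j = mean (\<lambda>t. f t * cis (- (of_int j * t)))"

text \<open>Continuity on the closed interval is what integrability over one period asks for; the
  values at the two end points may differ.\<close>

abbreviation cont_circle :: "(real \<Rightarrow> 'a::banach) \<Rightarrow> bool" where
  "cont_circle f \<equiv> continuous_on {-pi..pi} f"

lemma continuous_on_cis_comp [continuous_intros]: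
  "continuous_on S f \<Longrightarrow> continuous_on S (\<lambda>x. cis (f x))"
  unfolding cis_conv_exp by (intro continuous_intros)

lemma cont_circle_integrable: "cont_circle f \<Longrightarrow> f integrable_on {-pi..pi}"
  by (rule integrable_continuous_real)

lemma mean_add: "cont_circle f \<Longrightarrow> cont_circle g \<Longrightarrow> mean (\<lambda>t. f t + g t) = mean f + mean g"
  unfolding mean_def by (simp add: integral_add cont_circle_integrable scaleR_add_right)

lemma mean_diff: "cont_circle f \<Longrightarrow> cont_circle g \<Longrightarrow> mean (\<lambda>t. f t - g t) = mean f - mean g"
  unfolding mean_def by (simp add: integral_diff cont_circle_integrable scaleR_diff_right)

lemma mean_sum:
  "finite I \<Longrightarrow> (\<And>i. i \<in> I \<Longrightarrow> cont_circle (f i)) \<Longrightarrow> mean (\<lambda>t. \<Sum>i\<in>I. f i t) = (\<Sum>i\<in>I. mean (f i))"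
  unfolding mean_def by (simp add: integral_sum cont_circle_integrable scaleR_sum_right)

lemma mean_cmult: "mean (\<lambda>t. (c::complex) * f t) = c * mean f"
  unfolding mean_def by simp

lemma mean_rmult: "mean (\<lambda>t. (c::real) * f t) = c * mean f"
  unfolding mean_def by simp

lemma mean_const [simp]: "mean (\<lambda>t. c) = c"
  unfolding mean_def by (simp add: pi_ge_zero)

lemma mean_bounded_linear:
  assumes "bounded_linear h" "cont_circle f" shows "mean (\<lambda>t. h (f t)) = h (mean f)"
  using integral_linear[OF cont_circle_integrable[OF assms(2)] assms(1)]
  unfolding mean_def by (simp only: o_def linear_scale[OF bounded_linear.linear[OF assms(1)]])

lemma mean_Re: "cont_circle f \<Longrightarrow> mean (\<lambda>t. Re (f t)) = Re (mean f)"
  by (rule mean_bounded_linear[OF bounded_linear_Re])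

lemma mean_cnj: "cont_circle f \<Longrightarrow> mean (\<lambda>t. cnj (f t)) = cnj (mean f)"
  by (rule mean_bounded_linear[OF bounded_linear_cnj])

lemma mean_of_real: "cont_circle f \<Longrightarrow> mean (\<lambda>t. complex_of_real (f t)) = of_real (mean f)"
  by (rule mean_bounded_linear[OF bounded_linear_of_real])

lemma mean_mono:
  fixes f g :: "real \<Rightarrow> real"
  assumes "cont_circle f" "cont_circle g" "\<And>t. f t \<le> g t"
  shows "mean f \<le> mean g"
proof -
  have "integral {-pi..pi} f \<le> integral {-pi..pi} g"
    by (intro integral_le cont_circle_integrable assms)
  then show ?thesis unfolding mean_def by (simp add: divide_right_mono)
qed

lemma mean_norm_le: 
  assumes "cont_circle f" "cont_circle g" "\<And>t. norm (f t) \<le> g t"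
  shows "norm (mean f) \<le> mean g"
proof -
  have "norm (integral {-pi..pi} f) \<le> integral {-pi..pi} g"
    by (intro integral_norm_bound_integral cont_circle_integrable assms)
  then show ?thesis unfolding mean_def by (simp add: divide_right_mono)
qed

lemma mean_nonneg:
  fixes f :: "real \<Rightarrow> real"
  shows "cont_circle f \<Longrightarrow> (\<And>t. 0 \<le> f t) \<Longrightarrow> 0 \<le> mean f"
  using mean_mono[of "\<lambda>_. 0" f] by simp

lemma mean_tendsto:
  assumes "uniform_limit UNIV f g sequentially" "\<And>n. cont_circle (f n)"
  shows "(\<lambda>n. mean (f n)) \<longlonglongrightarrow> mean g"
proof -
  have "uniform_limit {-pi..pi} f g sequentially"
    using assms(1) by (rule uniform_limit_on_subset) simp
  then obtain I J where I: "\<And>n. (f n has_integral I n) {-pi..pi}" "(g has_integral J) {-pi..pi}"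
      "I \<longlonglongrightarrow> J"
    by (rule uniform_limit_integral[OF _ assms(2) trivial_limit_sequentially]) blast
  have "mean (f n) = (1 / (2 * pi)) *\<^sub>R I n" for n
    using I(1) by (simp add: mean_def integral_unique)
  moreover have "mean g = (1 / (2 * pi)) *\<^sub>R J"
    using I(2) by (simp add: mean_def integral_unique)
  ultimately show ?thesis using I(3) by (auto intro!: tendsto_intros)
qed

lemma periodic_shift_int:
  assumes "periodic_2pi f" shows "f (t + 2 * pi * of_int j) = f t"
proof -
  have nat: "f (t + 2 * pi * real m) = f t" for m t
  proof (induction m)
    case (Suc m)
    have "f (t + 2 * pi * real (Suc m)) = f (t + 2 * pi * real m + 2 * pi)"
      by (simp add: algebra_simps)
    with Suc assms show ?case by (simp add: periodic_2pi_def)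
  qed simp
  show ?thesis
  proof (cases "j \<ge> 0")
    case True then show ?thesis using nat[of t "nat j"] by simp
  next
    case False
    then show ?thesis using nat[of "t + 2 * pi * of_int j" "nat (-j)"] by simp
  qed
qed

text \<open>Periodicity first reduces the shift to \<open>r\<close> in \<open>[0, 2 * pi]\<close>.
  For such a shift, the piece of the integral lost at the left end equals the piece gained at the
  right end.\<close>

lemma mean_shift:
  fixes f :: "real \<Rightarrow> 'a::euclidean_space"
  assumes cont: "continuous_on UNIV f" and per: "periodic_2pi f"
  shows "mean (\<lambda>t. f (t + s)) = mean f"
proof -
  have main: "integral {-pi + s..pi + s} f = integral {-pi..pi} f" if "0 \<le> s" "s \<le> 2 * pi" for s
  proof -
    have int: "f integrable_on {a..b}" for a b
      by (rule integrable_continuous_real[OF continuous_on_subset[OF cont]]) simp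
    have "integral {-pi..-pi + s} f + integral {-pi + s..pi} f = integral {-pi..pi} f"
      using that by (intro Henstock_Kurzweil_Integration.integral_combine int) auto
    moreover have "integral {-pi + s..pi} f + integral {pi..pi + s} f = integral {-pi + s..pi + s} f"
      using that by (intro Henstock_Kurzweil_Integration.integral_combine int) auto
    moreover have "integral {pi..pi + s} f = integral {-pi..-pi + s} f"
    proof -
      have "f \<circ> (+) (2 * pi) = f"
        using per by (auto simp: periodic_2pi_def add.commute)
      then show ?thesis
        using integral_shift_Icc_real[of "-pi" "-pi + s" f "2 * pi"] by (simp add: add.commute)
    qed
    ultimately show ?thesis by (simp add: algebra_simps)
  qed
  define r where "r = s - 2 * pi * of_int \<lfloor>s / (2 * pi)\<rfloor>"
  have r: "0 \<le> r" "r \<le> 2 * pi"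
  proof -
    define x where "x = s / (2 * pi)"
    have "r = 2 * pi * (x - of_int \<lfloor>x\<rfloor>)"
      by (simp add: r_def x_def right_diff_distrib)
    moreover have "0 \<le> x - of_int \<lfloor>x\<rfloor>" "x - of_int \<lfloor>x\<rfloor> \<le> 1"
      by linarith+
    ultimately show "0 \<le> r" "r \<le> 2 * pi"
      by (auto intro: mult_left_le)
  qed
  have "f (t + s) = f (t + r)" for t
    using periodic_shift_int[OF per, of "t + r" "\<lfloor>s / (2 * pi)\<rfloor>"] by (simp add: r_def)
  moreover have "integral {-pi..pi} (\<lambda>t. f (t + r)) = integral {-pi + r..pi + r} f"
    using integral_shift_Icc_real[of "-pi" pi f r] by (simp add: o_def add.commute)
  ultimately show ?thesis using main[OF r] by (simp add: mean_def)
qed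

lemma has_vector_derivative_cis_mult:
  "((\<lambda>t. cis (c * t)) has_vector_derivative (\<i> * of_real c * cis (c * t))) (at t within S)"
proof -
  have "((\<lambda>z. exp (\<i> * (of_real c * z))) has_field_derivative
      \<i> * of_real c * exp (\<i> * (of_real c * of_real t))) (at (of_real t))"
    by (auto intro!: derivative_eq_intros)
  from has_vector_derivative_real_field[OF this] show ?thesis
    by (simp add: cis_conv_exp)
qed

lemma cis_int_pi: "cis (of_int j * pi) = cis (- (of_int j * pi))"
  by (simp add: complex_eq_iff sin_times_pi_eq_0 mult.commute)

lemma mean_cis: "mean (\<lambda>t. cis (of_int j * t)) = (if j = 0 then 1 else 0)"
proof (cases "j = 0")
  case False
  have "((\<lambda>t. cis (of_int j * t)) has_integral
      (cis (of_int j * pi) / (\<i> * of_int j) - cis (of_int j * (-pi)) / (\<i> * of_int j))) {-pi..pi}"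
  proof (intro fundamental_theorem_of_calculus)
    fix t :: real
    show "((\<lambda>t. cis (of_int j * t) / (\<i> * of_int j)) has_vector_derivative cis (of_int j * t)) (at t within {-pi..pi})"
      using has_vector_derivative_mult_left[OF has_vector_derivative_cis_mult[of "of_int j" t "{-pi..pi}"], of "1 / (\<i> * of_int j)"] False
      by simp
  qed simp
  moreover have "cis (of_int j * pi) = cis (of_int j * (-pi))"
    using cis_int_pi[of j] by simp
  ultimately show ?thesis using False by (simp add: mean_def integral_unique)
qed (simp add: cis_zero)

section \<open>Fourier coefficients\<close>

lemma of_real_cmod_square: "(complex_of_real (cmod z))\<^sup>2 = z * cnj z"
  by (metis complex_norm_square of_real_power)

lemma cmod_diff_square: "(cmod (a - b))\<^sup>2 = (cmod a)\<^sup>2 + (cmod b)\<^sup>2 - 2 * Re (a * cnj b)"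
  by (simp add: cmod_power2) (simp add: power2_eq_square algebra_simps)

lemma cis_orthonormal:
  "mean (\<lambda>t. cis (of_int i * t) * cnj (cis (of_int j * t))) = (if i = j then 1 else 0)"
  using mean_cis[of "i - j"] by (simp add: cis_cnj cis_mult algebra_simps)

text \<open>Parseval for a finite sum of characters. The frequencies enter through an injective map
  \<open>r\<close>, so that one statement serves sums over positive and over negative
  frequencies.\<close>

lemma trig_poly_norm:
  assumes "finite J" "inj_on r J"
  shows "mean (\<lambda>t. (cmod (\<Sum>j\<in>J. a j * cis (of_int (r j) * t)))\<^sup>2) = (\<Sum>j\<in>J. (cmod (a j))\<^sup>2)"
proof -
  let ?u = "\<lambda>t. \<Sum>j\<in>J. a j * cis (of_int (r j) * t)"
  have "complex_of_real (mean (\<lambda>t. (cmod (?u t))\<^sup>2)) = mean (\<lambda>t. complex_of_real ((cmod (?u t))\<^sup>2))"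
    by (intro mean_of_real[symmetric] continuous_intros)
  also have "\<dots> = mean (\<lambda>t. \<Sum>i\<in>J. \<Sum>j\<in>J. (a i * cnj (a j)) * (cis (of_int (r i) * t) * cnj (cis (of_int (r j) * t))))"
    by (rule arg_cong[where f = mean])
       (simp add: of_real_cmod_square sum_product fun_eq_iff mult_ac)
  also have "\<dots> = (\<Sum>i\<in>J. \<Sum>j\<in>J. (a i * cnj (a j)) * mean (\<lambda>t. cis (of_int (r i) * t) * cnj (cis (of_int (r j) * t))))"
    by (simp add: mean_sum assms mean_cmult continuous_intros)
  also have "\<dots> = (\<Sum>i\<in>J. \<Sum>j\<in>J. (a i * cnj (a j)) * (if i = j then 1 else 0))"
    unfolding cis_orthonormal using assms(2) by (intro sum.cong refl) (auto dest: inj_onD)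
  also have "\<dots> = (\<Sum>i\<in>J. a i * cnj (a i))"
    by (simp add: assms if_distrib[of "\<lambda>x. _ * x"] cong: if_cong)
  also have "\<dots> = complex_of_real (\<Sum>j\<in>J. (cmod (a j))\<^sup>2)"
    by (simp add: of_real_cmod_square)
  finally show ?thesis by (simp only: of_real_eq_iff)
qed

text \<open>Expand the mean of \<open>(cmod (f t - u t))\<^sup>2\<close>, where \<open>u\<close> is
  the Fourier sum over \<open>J\<close>. The cross mean of \<open>f\<close> and \<open>u\<close> and
  the squared norm of \<open>u\<close> both equal the sum on the left, so the expansion leaves the
  difference of the two sides, which is nonnegative.\<close>

lemma bessel:
  assumes "finite J" and f: "cont_circle f"
  shows "(\<Sum>j\<in>J. (cmod (fcoeff f j))\<^sup>2) \<le> mean (\<lambda>t. (cmod (f t))\<^sup>2)"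
proof -
  let ?u = "\<lambda>t. \<Sum>j\<in>J. fcoeff f j * cis (of_int j * t)"
  let ?S = "\<Sum>j\<in>J. (cmod (fcoeff f j))\<^sup>2"
  have "mean (\<lambda>t. f t * cnj (?u t)) = mean (\<lambda>t. \<Sum>j\<in>J. cnj (fcoeff f j) * (f t * cis (- (of_int j * t))))"
    by (rule arg_cong[where f = mean]) (simp add: sum_distrib_left mult_ac cis_cnj fun_eq_iff)
  also have "\<dots> = (\<Sum>j\<in>J. cnj (fcoeff f j) * fcoeff f j)"
    by (simp add: mean_sum assms mean_cmult continuous_intros fcoeff_def)
  also have "\<dots> = complex_of_real ?S"
    by (simp add: of_real_cmod_square mult.commute)
  finally have fu: "mean (\<lambda>t. Re (f t * cnj (?u t))) = ?S"
    by (subst mean_Re) (intro continuous_intros f, simp only: Re_complex_of_real)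
  have "0 \<le> mean (\<lambda>t. (cmod (f t - ?u t))\<^sup>2)"
    by (intro mean_nonneg continuous_intros f) simp
  also have "\<dots> = mean (\<lambda>t. (cmod (f t))\<^sup>2 + (cmod (?u t))\<^sup>2 - 2 * Re (f t * cnj (?u t)))"
    by (simp only: cmod_diff_square)
  also have "\<dots> = mean (\<lambda>t. (cmod (f t))\<^sup>2) + mean (\<lambda>t. (cmod (?u t))\<^sup>2) - 2 * mean (\<lambda>t. Re (f t * cnj (?u t)))"
    by (subst mean_diff mean_add, (intro continuous_intros f)+)+ (simp only: mean_rmult)
  also have "\<dots> = mean (\<lambda>t. (cmod (f t))\<^sup>2) - ?S"
    unfolding fu using trig_poly_norm[OF assms(1), of "\<lambda>j. j" "fcoeff f"] by simp
  finally show ?thesis by simp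
qed

lemma fcoeff_shift:
  assumes "continuous_on UNIV f" "periodic_2pi f"
  shows "fcoeff (\<lambda>t. f (t + s)) j = cis (of_int j * s) * fcoeff f j"
proof -
  have "mean (\<lambda>t. f (t + s) * cis (- (of_int j * (t + s)))) = mean (\<lambda>t. f t * cis (- (of_int j * t)))"
  proof (rule mean_shift[of "\<lambda>t. f t * cis (- (of_int j * t))"])
    show "periodic_2pi (\<lambda>t. f t * cis (- (of_int j * t)))"
      unfolding periodic_2pi_def
    proof
      fix t
      have "cis (- (of_int j * (t + 2 * pi))) = cis (- (of_int j * t)) * cis (2 * pi * of_int (-j))"
        by (simp add: cis_mult algebra_simps)
      also have "cis (2 * pi * of_int (-j)) = 1" by (rule cis_multiple_2pi) auto
      finally show "f (t + 2 * pi) * cis (- (of_int j * (t + 2 * pi))) = f t * cis (- (of_int j * t))"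
        using assms(2) by (simp add: periodic_2pi_def)
    qed
  qed (intro continuous_intros assms)
  moreover have "f (t + s) * cis (- (of_int j * t)) = cis (of_int j * s) * (f (t + s) * cis (- (of_int j * (t + s))))" for t
    by (simp add: cis_mult algebra_simps)
  then have "fcoeff (\<lambda>t. f (t + s)) j = mean (\<lambda>t. cis (of_int j * s) * (f (t + s) * cis (- (of_int j * (t + s)))))"
    unfolding fcoeff_def by presburger
  ultimately show ?thesis unfolding mean_cmult fcoeff_def by simp
qed

text \<open>Integration by parts; the boundary terms cancel by periodicity. The fundamental theorem
  gives the integral of the derivative of the product, and subtracting the continuous summand yields
  both the existence and the value of the integral of \<open>f'\<close> times the character.\<close>

lemma fcoeff_deriv:
  assumes per: "periodic_2pi f"
    and der: "\<And>t. (f has_vector_derivative f' t) (at t)"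
  shows "fcoeff f' j = \<i> * of_int j * fcoeff f j"
proof -
  let ?e = "\<lambda>t. cis (- (of_int j * t))"
  have e: "(?e has_vector_derivative (- (\<i> * of_int j) * ?e t)) (at t within S)" for t S
    using has_vector_derivative_cis_mult[of "- of_int j" t S] by simp
  have contf: "continuous_on S f" for S
    using der by (meson continuous_at_imp_continuous_on has_vector_derivative_continuous)
  have I1: "((\<lambda>t. f t * (- (\<i> * of_int j) * ?e t) + f' t * ?e t) has_integral f pi * ?e pi - f (-pi) * ?e (-pi)) {-pi..pi}"
    by (intro fundamental_theorem_of_calculus has_vector_derivative_mult e
         has_vector_derivative_at_within[OF der]) auto
  have "f (-pi) = f pi"
    using per[unfolded periodic_2pi_def, rule_format, of "-pi"] by simp
  then have bd: "f pi * ?e pi - f (-pi) * ?e (-pi) = 0"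
    using cis_int_pi[of j] by simp
  have "(\<lambda>t. f t * (- (\<i> * of_int j) * ?e t)) integrable_on {-pi..pi}"
    by (intro integrable_continuous_real continuous_intros contf)
  from has_integral_diff[OF I1 integrable_integral[OF this]]
  have "((\<lambda>t. f' t * ?e t) has_integral - integral {-pi..pi} (\<lambda>t. - (\<i> * of_int j) * (f t * ?e t))) {-pi..pi}"
    unfolding bd by (simp add: mult_ac)
  then have "integral {-pi..pi} (\<lambda>t. f' t * ?e t) = (\<i> * of_int j) * integral {-pi..pi} (\<lambda>t. f t * ?e t)"
    unfolding integral_mult_right by (simp add: integral_unique)
  then show ?thesis unfolding fcoeff_def mean_def by simp
qed

section \<open>Pointwise and absolute convergence of Fourier series\<close>

text \<open>Riemann-Lebesgue: along an injective enumeration of frequencies, Bessel's inequality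
  makes the squared coefficients summable.\<close>

lemma fcoeff_tendsto_0:
  assumes "cont_circle f" and r: "inj r"
  shows "(\<lambda>n. fcoeff f (r n)) \<longlonglongrightarrow> 0"
proof -
  have "summable (\<lambda>n. (cmod (fcoeff f (r n)))\<^sup>2)"
  proof (rule summableI_nonneg_bounded)
    fix n
    have "(\<Sum>i<n. (cmod (fcoeff f (r i)))\<^sup>2) = (\<Sum>j\<in>r ` {..<n}. (cmod (fcoeff f j))\<^sup>2)"
      using r by (simp add: sum.reindex inj_on_subset[OF r])
    also have "\<dots> \<le> mean (\<lambda>t. (cmod (f t))\<^sup>2)" by (rule bessel) (use assms in auto)
    finally show "(\<Sum>i<n. (cmod (fcoeff f (r i)))\<^sup>2) \<le> mean (\<lambda>t. (cmod (f t))\<^sup>2)" .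
  qed simp
  then have "(\<lambda>n. (cmod (fcoeff f (r n)))\<^sup>2) \<longlonglongrightarrow> 0" by (rule summable_LIMSEQ_zero)
  then have "(\<lambda>n. sqrt ((cmod (fcoeff f (r n)))\<^sup>2)) \<longlonglongrightarrow> sqrt 0" by (rule tendsto_real_sqrt)
  then show ?thesis by (simp add: tendsto_norm_zero_iff)
qed

lemma has_vector_derivative_quotient:
  fixes g :: "real \<Rightarrow> complex"
  assumes "(g has_vector_derivative g') (at 0)"
  shows "((\<lambda>t. (g t - g 0) / of_real t) \<longlongrightarrow> g') (at 0)"
proof -
  have "((\<lambda>h. cmod (g h - g 0 - of_real h * g') / \<bar>h\<bar>) \<longlongrightarrow> 0) (at 0)"
    using assms unfolding has_vector_derivative_def has_derivative_at
    by (simp add: scaleR_conv_of_real)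
  then have "((\<lambda>t. cmod ((g t - g 0) / of_real t - g')) \<longlongrightarrow> 0) (at 0)"
  proof (rule Lim_transform_eventually)
    have "cmod (g t - g 0 - of_real t * g') / \<bar>t\<bar> = cmod ((g t - g 0) / of_real t - g')" if "t \<noteq> 0" for t
    proof -
      have "(g t - g 0) / of_real t - g' = (g t - g 0 - of_real t * g') / of_real t"
        using that by (simp add: field_simps)
      then show ?thesis by (simp add: norm_divide)
    qed
    then show "\<forall>\<^sub>F t in at 0. cmod (g t - g 0 - of_real t * g') / \<bar>t\<bar> = cmod ((g t - g 0) / of_real t - g')"
      by (auto simp: eventually_at intro!: exI[of _ 1])
  qed
  then show ?thesis by (simp add: tendsto_norm_zero_iff LIM_zero_iff)
qed

text \<open>Dividing \<open>f t - f 0\<close> by \<open>cis t - 1\<close> turns the symmetric partial sums into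
  a telescoping sum, so convergence follows from the Riemann--Lebesgue lemma.\<close>

lemma fourier_series_at_0:
  fixes f :: "real \<Rightarrow> complex"
  assumes cont: "continuous_on UNIV f" and der: "(f has_vector_derivative d) (at 0)"
  shows "(\<lambda>n. \<Sum>j\<in>{- int n..int n}. fcoeff f j) \<longlonglongrightarrow> f 0"
proof -
  \<comment> \<open>The value at 0 is the quotient of the derivatives of \<open>f\<close> and
    \<open>cis\<close> there, which makes \<open>h\<close> continuous at 0.\<close>
  define h where "h t = (if t = 0 then d / \<i> else (f t - f 0) / (cis t - 1))" for t
  have nz: "cis t \<noteq> 1" if "t \<in> {-pi..pi}" "t \<noteq> 0" for t
  proof
    assume "cis t = 1"
    then have "cos t = 1" by (simp add: complex_eq_iff)
    then obtain m :: int where m: "t = of_int m * 2 * pi" unfolding cos_one_2pi_int by auto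
    then have "m \<noteq> 0" using that by auto
    then have "1 \<le> \<bar>m\<bar>" by simp
    then have "1 \<le> \<bar>real_of_int m\<bar>" by linarith
    then have "2 * pi \<le> \<bar>t\<bar>" by (simp add: m abs_mult)
    moreover have "\<bar>t\<bar> \<le> pi" using that by auto
    ultimately show False using pi_gt_zero by linarith
  qed
  have conth: "cont_circle h"
    unfolding continuous_on_eq_continuous_within
  proof
    fix x assume x: "x \<in> {-pi..pi}"
    show "continuous (at x within {-pi..pi}) h"
    proof (cases "x = 0")
      case True
      have "(cis has_vector_derivative \<i>) (at 0)"
        using has_vector_derivative_cis_mult[of 1 0] by simp
      note lim = tendsto_divide[OF has_vector_derivative_quotient[OF der] has_vector_derivative_quotient[OF this]]
      have "(h \<longlongrightarrow> d / \<i>) (at 0)"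
      proof (rule Lim_transform_eventually)
        show "((\<lambda>t. ((f t - f 0) / of_real t) / ((cis t - cis 0) / of_real t)) \<longlongrightarrow> d / \<i>) (at 0)"
          by (rule lim) simp
        show "\<forall>\<^sub>F t in at 0. ((f t - f 0) / of_real t) / ((cis t - cis 0) / of_real t) = h t"
          by (auto simp: eventually_at h_def intro!: exI[of _ 1])
      qed
      then have "(h \<longlongrightarrow> h x) (at x within {-pi..pi})"
        using True by (auto simp: h_def intro: tendsto_within_subset)
      then show ?thesis by (simp add: continuous_within)
    next
      case False
      have "continuous (at x) f" "continuous (at x) cis"
        using cont has_vector_derivative_continuous[OF has_vector_derivative_cis_mult[of 1 x]]
        by (auto simp: continuous_on_eq_continuous_at)
      then have "continuous (at x within {-pi..pi}) (\<lambda>t. (f t - f 0) / (cis t - 1))"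
        using nz[OF x False]
        by (intro continuous_intros) (auto intro: continuous_at_imp_continuous_at_within)
      moreover have "\<forall>\<^sub>F t in at x within {-pi..pi}. (f t - f 0) / (cis t - 1) = h t"
        using False by (auto simp: eventually_at h_def intro!: exI[of _ "\<bar>x\<bar>"] simp: dist_real_def)
      ultimately show ?thesis
        using False unfolding continuous_within h_def
        by (simp add: tendsto_cong)
    qed
  qed
  have eq: "f t = f 0 + (cis t - 1) * h t" if "t \<in> {-pi..pi}" for t
    using nz[OF that] by (auto simp: h_def)
  \<comment> \<open>Multiplication by \<open>cis t\<close> moves the frequency by one, so apart from
    the constant \<open>f 0\<close> each coefficient of \<open>f\<close> is a difference of
    neighbouring coefficients of \<open>h\<close>. Only the two outermost ones survive in the
    symmetric sum.\<close>
  have co: "fcoeff f j = (if j = 0 then f 0 else 0) + fcoeff h (j - 1) - fcoeff h j" for j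
  proof -
    have "fcoeff f j = mean (\<lambda>t. f 0 * cis (of_int (-j) * t) + h t * cis (- (of_int (j - 1) * t)) - h t * cis (- (of_int j * t)))"
      unfolding fcoeff_def mean_def
    proof (intro arg_cong[where f = "scaleR _"] integral_cong)
      fix t assume t: "t \<in> {-pi..pi}"
      have "cis t * cis (- (of_int j * t)) = cis (- (of_int (j - 1) * t))"
        by (simp add: cis_mult algebra_simps)
      then show "f t * cis (- (of_int j * t)) = f 0 * cis (of_int (-j) * t) + h t * cis (- (of_int (j - 1) * t)) - h t * cis (- (of_int j * t))"
        unfolding eq[OF t] by (simp add: algebra_simps)
    qed
    also have "\<dots> = mean (\<lambda>t. f 0 * cis (of_int (-j) * t)) + fcoeff h (j - 1) - fcoeff h j"
      unfolding fcoeff_def by (subst mean_diff mean_add, (intro continuous_intros conth)+)+ simp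
    finally show ?thesis unfolding mean_cmult mean_cis by simp
  qed
  have part: "(\<Sum>j\<in>{- int n..int n}. fcoeff f j) = f 0 + fcoeff h (- int n - 1) - fcoeff h (int n)" for n
  proof (induction n)
    case (Suc n)
    have "{- int (Suc n)..int (Suc n)} = insert (- int (Suc n)) (insert (int (Suc n)) {- int n..int n})" by auto
    then show ?case using Suc by (simp add: co algebra_simps) (rule arg_cong[where f = "fcoeff h"], simp)
  qed (simp add: co)
  have "(\<lambda>n. fcoeff h (- int n - 1)) \<longlonglongrightarrow> 0" "(\<lambda>n. fcoeff h (int n)) \<longlonglongrightarrow> 0"
    by (intro fcoeff_tendsto_0 conth; simp add: inj_def)+
  from tendsto_diff[OF tendsto_add[OF tendsto_const[of "f 0"] this(1)] this(2)] show ?thesis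
    unfolding part by simp
qed

text \<open>Write \<open>a j\<close> as \<open>real j * a j\<close> times \<open>1 / real j\<close>
  and bound the product by half the sum of the squares.\<close>

lemma summable_of_weighted_squares:
  fixes a :: "nat \<Rightarrow> real"
  assumes "summable (\<lambda>j. (real j * a j)\<^sup>2)" "\<And>j. a j \<ge> 0"
  shows "summable a"
proof (rule summable_comparison_test')
  show "summable (\<lambda>j. ((real j * a j)\<^sup>2 + 1 / real j ^ 2) / 2)"
    by (intro summable_divide summable_add assms inverse_power_summable[of 2, unfolded inverse_eq_divide]) simp
  fix j :: nat assume "1 \<le> j"
  then have "a j = (real j * a j) * (1 / real j)" by simp
  also have "\<dots> \<le> ((real j * a j)\<^sup>2 + (1 / real j)\<^sup>2) / 2"
  proof -
    have "x * y \<le> (x\<^sup>2 + y\<^sup>2) / 2" for x y :: real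
      using sum_squares_bound[of x y] by simp
    then show ?thesis .
  qed
  finally show "norm (a j) \<le> ((real j * a j)\<^sup>2 + 1 / real j ^ 2) / 2"
    using assms(2)[of j] by (simp add: power_one_over)
qed

text \<open>Bessel's inequality for \<open>f'\<close> bounds the squares of
  \<open>real j * cmod (fcoeff f (r j))\<close>. The map \<open>r\<close> stands for either of the
  enumerations \<open>int j\<close> and \<open>- int j\<close>.\<close>

lemma fcoeff_C1_summable:
  assumes "periodic_2pi f" "\<And>t. (f has_vector_derivative f' t) (at t)" "continuous_on UNIV f'"
    and r: "inj r" "\<And>j. \<bar>r j\<bar> = int j"
  shows "summable (\<lambda>j. cmod (fcoeff f (r j)))"
proof (rule summable_of_weighted_squares)
  have contf': "cont_circle f'" using assms(3) continuous_on_subset by blast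
  have eq: "real j * cmod (fcoeff f (r j)) = cmod (fcoeff f' (r j))" for j
  proof -
    have "cmod (of_int (r j)) = real j"
      using r(2)[of j] by (metis norm_of_int of_int_abs of_int_of_nat_eq)
    then show ?thesis unfolding fcoeff_deriv[OF assms(1,2)] by (simp add: norm_mult)
  qed
  show "summable (\<lambda>j. (real j * cmod (fcoeff f (r j)))\<^sup>2)"
    unfolding eq
  proof (rule summableI_nonneg_bounded)
    fix n
    have "(\<Sum>i<n. (cmod (fcoeff f' (r i)))\<^sup>2) = (\<Sum>j\<in>r ` {..<n}. (cmod (fcoeff f' j))\<^sup>2)"
      by (simp add: sum.reindex inj_on_subset[OF r(1)])
    also have "\<dots> \<le> mean (\<lambda>t. (cmod (f' t))\<^sup>2)" by (rule bessel) (use contf' in auto)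
    finally show "(\<Sum>i<n. (cmod (fcoeff f' (r i)))\<^sup>2) \<le> mean (\<lambda>t. (cmod (f' t))\<^sup>2)" .
  qed simp
qed simp

lemma sum_symmetric_int:
  "(\<Sum>j\<in>{- int n..int n}. g j) = (\<Sum>j<Suc n. g (int j)) + (\<Sum>j<n. g (- int (Suc j)) :: complex)"
proof (induction n)
  case (Suc n)
  have "{- int (Suc n)..int (Suc n)} = insert (- int (Suc n)) (insert (int (Suc n)) {- int n..int n})" by auto
  then show ?case using Suc by (simp add: algebra_simps)
qed simp

text \<open>The value at \<open>t\<close> is the value at 0 of a translate of \<open>f\<close>,
  whose coefficients carry the factor \<open>cis (of_int j * t)\<close>. The symmetric partial sums
  therefore converge to \<open>f t\<close>, and absolute convergence permits splitting them into two
  one-sided series.\<close>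

proposition fourier_series_C1:
  fixes f :: "real \<Rightarrow> complex"
  assumes per: "periodic_2pi f" and der: "\<And>t. (f has_vector_derivative f' t) (at t)"
    and cont: "continuous_on UNIV f'"
  shows "summable (\<lambda>j. cmod (fcoeff f (int j)))"
    and "summable (\<lambda>j. cmod (fcoeff f (- int j)))"
    and "f t = (\<Sum>j. fcoeff f (int j) * cis (real j * t))
             + (\<Sum>j. fcoeff f (- int (Suc j)) * cis (- (real (Suc j) * t)))"
proof -
  show s1: "summable (\<lambda>j. cmod (fcoeff f (int j)))"
    by (rule fcoeff_C1_summable[OF assms]) (auto simp: inj_def)
  show s2: "summable (\<lambda>j. cmod (fcoeff f (- int j)))"
    by (rule fcoeff_C1_summable[OF assms]) (auto simp: inj_def)
  have contf: "continuous_on UNIV f"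
    using der by (meson continuous_at_imp_continuous_on has_vector_derivative_continuous)
  let ?g = "\<lambda>j. fcoeff f j * cis (of_int j * t)"
  have "((\<lambda>u. f (u + t)) has_vector_derivative f' t) (at 0)"
  proof -
    have "((\<lambda>u. u + t) has_vector_derivative 1) (at 0)"
      by (auto intro!: derivative_eq_intros)
    from vector_diff_chain_at[OF this, of f "f' t"] der[of t] show ?thesis
      by (simp add: o_def)
  qed
  moreover have "continuous_on UNIV (\<lambda>u. f (u + t))"
    by (rule continuous_on_compose2[OF contf]) (auto intro!: continuous_intros)
  ultimately have "(\<lambda>n. \<Sum>j\<in>{- int n..int n}. fcoeff (\<lambda>u. f (u + t)) j) \<longlonglongrightarrow> f t"
    using fourier_series_at_0[of "\<lambda>u. f (u + t)"] by simp
  then have lim: "(\<lambda>n. (\<Sum>j<Suc n. ?g (int j)) + (\<Sum>j<n. ?g (- int (Suc j)))) \<longlonglongrightarrow> f t"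
    unfolding fcoeff_shift[OF contf per] by (subst sum_symmetric_int[symmetric]) (simp add: mult.commute)
  have "summable (\<lambda>j. ?g (int j))"
    by (rule summable_norm_cancel) (simp add: norm_mult s1)
  then have l1: "(\<lambda>n. \<Sum>j<Suc n. ?g (int j)) \<longlonglongrightarrow> (\<Sum>j. ?g (int j))"
    by (intro LIMSEQ_Suc summable_LIMSEQ)
  have "summable (\<lambda>j. ?g (- int (Suc j)))"
    using s2 summable_Suc_iff[of "\<lambda>j. cmod (fcoeff f (- int j))"]
    by (intro summable_norm_cancel[where f = "\<lambda>j. ?g (- int (Suc j))"]) (simp add: norm_mult)
  then have l2: "(\<lambda>n. \<Sum>j<n. ?g (- int (Suc j))) \<longlonglongrightarrow> (\<Sum>j. ?g (- int (Suc j)))"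
    by (rule summable_LIMSEQ)
  from LIMSEQ_unique[OF lim tendsto_add[OF l1 l2]]
  have "f t = (\<Sum>j. ?g (int j)) + (\<Sum>j. ?g (- int (Suc j)))" .
  moreover have "of_int (int j) * t = real j * t" "of_int (- int (Suc j)) * t = - (real (Suc j) * t)" for j
    by (simp_all add: algebra_simps)
  ultimately show "f t = (\<Sum>j. fcoeff f (int j) * cis (real j * t))
             + (\<Sum>j. fcoeff f (- int (Suc j)) * cis (- (real (Suc j) * t)))"
    by presburger
qed

section \<open>Boundary values of functions in the disc algebra\<close>

definition disc_alg :: "(complex \<Rightarrow> complex) \<Rightarrow> bool" where
  "disc_alg G \<longleftrightarrow> continuous_on (cball 0 1) G \<and> G holomorphic_on ball 0 1"

lemma disc_alg_mult: "disc_alg F \<Longrightarrow> disc_alg G \<Longrightarrow> disc_alg (\<lambda>z. F z * G z)"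
  and disc_alg_exp: "disc_alg F \<Longrightarrow> disc_alg (\<lambda>z. exp (c * F z))"
  and disc_alg_power: "disc_alg (\<lambda>z. z ^ m)"
  unfolding disc_alg_def by (safe; intro continuous_intros holomorphic_intros; assumption?)+

lemma disc_alg_continuous: 
  assumes "disc_alg G" shows "continuous_on S (\<lambda>t. G (cis t))"
proof -
  have "continuous_on (cball 0 1) G" using assms by (simp add: disc_alg_def)
  then show ?thesis
    by (rule continuous_on_compose2) (auto intro!: continuous_on_cis_comp continuous_on_id)
qed

text \<open>Cauchy's formula at the centre, valid up to the boundary by continuity on the closed
  disc. It makes the mean multiplicative on boundary values of analytic functions, so a product with
  a factor vanishing at 0 has mean 0.\<close>

lemma mean_disc_alg:
  assumes "disc_alg G" shows "mean (\<lambda>t. G (cis t)) = G 0"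
proof -
  have "((\<lambda>u. G u / (u - 0)) has_contour_integral (2 * of_real pi * \<i> * G 0)) (circlepath 0 1)"
    using assms unfolding disc_alg_def by (intro Cauchy_integral_circlepath) auto
  then have "((\<lambda>t. G (cis t) / cis t * \<i> * cis t) has_integral 2 * of_real pi * \<i> * G 0) {0..2 * pi}"
    unfolding circlepath_def by (subst (asm) has_contour_integral_part_circlepath_iff) simp_all
  then have "((\<lambda>t. \<i> * G (cis t)) has_integral \<i> * (2 * of_real pi * G 0)) {0..2 * pi}"
    by (simp add: mult_ac)
  from has_integral_mult_right[OF this, of "-\<i>"]
  have "((\<lambda>t. G (cis t)) has_integral (2 * of_real pi * G 0)) {0..2 * pi}"
    by (simp flip: mult.assoc)
  then have "integral {0..2*pi} (\<lambda>t. G (cis t)) = 2 * of_real pi * G 0" by (rule integral_unique)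
  moreover have "integral {-pi..pi} (\<lambda>t. G (cis (t + pi))) = integral {0..2*pi} (\<lambda>t. G (cis t))"
    using integral_shift_Icc_real[of "-pi" pi "\<lambda>t. G (cis t)" pi] by (simp add: o_def add.commute)
  moreover have "mean (\<lambda>t. G (cis (t + pi))) = mean (\<lambda>t. G (cis t))"
    by (rule mean_shift) (auto simp: disc_alg_continuous[OF assms] periodic_2pi_def cis_mult[symmetric])
  ultimately show ?thesis by (simp add: mean_def scaleR_conv_of_real)
qed

lemma disc_alg_series:
  assumes "summable (\<lambda>j. cmod (a j))" shows "disc_alg (\<lambda>z. \<Sum>j. a j * z ^ j)"
  unfolding disc_alg_def
proof
  have bd: "norm (a j * z ^ j) \<le> cmod (a j)" if "z \<in> cball 0 1" for j z
    using that by (simp add: norm_mult norm_power mult_left_le power_le_one)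
  show "continuous_on (cball 0 1) (\<lambda>z. \<Sum>j. a j * z ^ j)"
    by (rule uniform_limit_theorem[OF _ Weierstrass_m_test[OF bd assms]])
       (auto intro!: continuous_intros always_eventually)
  have "summable (\<lambda>j. a j * z ^ j)" if "z \<in> ball 0 1" for z
    using that by (intro summable_comparison_test'[OF assms, of 0] bd) auto
  then show "(\<lambda>z. \<Sum>j. a j * z ^ j) holomorphic_on ball 0 1"
    by (intro power_series_holomorphic[where a = a]) (simp add: summable_sums)
qed

section \<open>Orthonormal polynomials and the defect from 1\<close>

lemma inner_w_mean:
  "inner_w \<phi> f g = mean (\<lambda>t. poly f (cis t) * cnj (poly g (cis t)) * complex_of_real (\<phi> t))"
  by (simp add: inner_w_def mean_def cis_conv_exp scaleR_conv_of_real)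

lemma orthonormal_polys_lead_coeff:
  assumes "orthonormal_polys \<phi> p"
  shows "lead_coeff (p m) = complex_of_real (Re (lead_coeff (p m)))" "lead_coeff (p m) \<noteq> 0"
proof -
  have "Im (lead_coeff (p m)) = 0" "Re (lead_coeff (p m)) > 0"
    using assms unfolding orthonormal_polys_def by blast+
  then show "lead_coeff (p m) = complex_of_real (Re (lead_coeff (p m)))" "lead_coeff (p m) \<noteq> 0"
    by (auto simp: complex_eq_iff simp del: leading_coeff_0_iff)
qed

text \<open>Induction on \<open>d\<close>: a multiple of \<open>p d\<close> removes the coefficient
  of index \<open>d\<close> from \<open>s\<close>. The bound on \<open>s\<close> is phrased by
  vanishing coefficients instead of a degree so that \<open>d = 0\<close> describes the zero
  polynomial.\<close>

lemma inner_w_orthogonal: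
  assumes orth: "orthonormal_polys \<phi> p" and \<phi>: "cont_circle \<phi>"
  shows "(\<And>i. i \<ge> d \<Longrightarrow> coeff s i = 0) \<Longrightarrow> d \<le> m \<Longrightarrow> inner_w \<phi> (p m) s = 0"
proof (induction d arbitrary: s)
  case 0
  then have "s = 0" by (simp add: poly_eq_iff)
  then show ?case by (simp add: inner_w_mean)
next
  case (Suc d)
  define c where "c = coeff s d / lead_coeff (p d)"
  note lc = orthonormal_polys_lead_coeff[OF orth, of d]
  have deg: "degree (p d) = d"
    using orth unfolding orthonormal_polys_def by blast
  have "inner_w \<phi> (p m) (s - smult c (p d)) = 0"
  proof (rule Suc.IH)
    fix i assume "d \<le> i"
    then consider "i = d" | "Suc d \<le> i" by linarith
    then show "coeff (s - smult c (p d)) i = 0"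
    proof cases
      case 1 then show ?thesis using deg lc by (simp add: c_def)
    next
      case 2
      then show ?thesis using Suc.prems(1)[of i] deg coeff_eq_0[of "p d" i] by simp
    qed
  qed (use Suc.prems in simp)
  moreover have "inner_w \<phi> (p m) (p d) = 0"
    using orth Suc.prems(2) unfolding orthonormal_polys_def by auto
  moreover have "inner_w \<phi> (p m) s = inner_w \<phi> (p m) (s - smult c (p d)) + cnj c * inner_w \<phi> (p m) (p d)"
    unfolding inner_w_mean
    by (subst mean_cmult[symmetric], subst mean_add[symmetric])
       (auto intro!: continuous_intros \<phi> simp: algebra_simps)
  ultimately show ?case by simp
qed

text \<open>Subtracting the right multiple of \<open>p m\<close> from \<open>s\<close> leaves a
  polynomial of lower degree, which is orthogonal to \<open>p m\<close>. The conjugate appears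
  because the form is antilinear in its second argument.\<close>

lemma inner_w_lead_coeff:
  assumes orth: "orthonormal_polys \<phi> p" and \<phi>: "cont_circle \<phi>"
    and deg: "degree s \<le> m"
  shows "inner_w \<phi> (p m) s = cnj (coeff s m) / Re (lead_coeff (p m))"
proof -
  define c where "c = coeff s m / lead_coeff (p m)"
  note lc = orthonormal_polys_lead_coeff(2)[OF orth, of m]
    and re = orthonormal_polys_lead_coeff(1)[OF orth, of m]
  have dp: "degree (p m) = m"
    using orth unfolding orthonormal_polys_def by blast
  have "inner_w \<phi> (p m) (s - smult c (p m)) = 0"
  proof (rule inner_w_orthogonal[OF orth \<phi>, of m])
    fix i assume "m \<le> i"
    then consider "i = m" | "m < i" by linarith
    then show "coeff (s - smult c (p m)) i = 0"
      by cases (use dp lc deg coeff_eq_0[of "p m" i] coeff_eq_0[of s i] in \<open>auto simp: c_def\<close>)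
  qed simp
  moreover have "inner_w \<phi> (p m) (p m) = 1"
    using orth unfolding orthonormal_polys_def by auto
  moreover have "inner_w \<phi> (p m) s = inner_w \<phi> (p m) (s - smult c (p m)) + cnj c * inner_w \<phi> (p m) (p m)"
    unfolding inner_w_mean
    by (subst mean_cmult[symmetric], subst mean_add[symmetric])
       (auto intro!: continuous_intros \<phi> simp: algebra_simps)
  moreover have "cnj c = cnj (coeff s m) / Re (lead_coeff (p m))"
    unfolding c_def by (subst re) simp
  ultimately show ?thesis by simp
qed

section \<open>Continuously differentiable functions and the splitting of their Fourier
  series\<close>

definition C1 :: "(real \<Rightarrow> complex) \<Rightarrow> bool" where
  "C1 f \<longleftrightarrow> (\<exists>f'. (\<forall>t. (f has_vector_derivative f' t) (at t)) \<and> continuous_on UNIV f')"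

lemma C1_continuous: "C1 f \<Longrightarrow> continuous_on S f"
  unfolding C1_def by (meson continuous_at_imp_continuous_on has_vector_derivative_continuous)

lemma C1_const: "C1 (\<lambda>t. c)"
  unfolding C1_def by (rule exI[of _ "\<lambda>t. 0"]) auto

lemma C1_cis: "C1 (\<lambda>t. cis (c * t))"
  unfolding C1_def
  by (rule exI[of _ "\<lambda>t. \<i> * of_real c * cis (c * t)"])
     (auto intro!: has_vector_derivative_cis_mult continuous_intros)

lemma C1_diff:
  assumes "C1 f" "C1 g" shows "C1 (\<lambda>t. f t - g t)"
proof -
  obtain f' g' where "\<forall>t. (f has_vector_derivative f' t) (at t)" "continuous_on UNIV f'"
     "\<forall>t. (g has_vector_derivative g' t) (at t)" "continuous_on UNIV g'"
    using assms unfolding C1_def by metis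
  then show ?thesis unfolding C1_def
    by (intro exI[of _ "\<lambda>t. f' t - g' t"] conjI allI has_vector_derivative_diff continuous_on_diff) auto
qed

lemma C1_mult:
  assumes "C1 f" "C1 g" shows "C1 (\<lambda>t. f t * g t)"
proof -
  obtain f' g' where "\<forall>t. (f has_vector_derivative f' t) (at t)" "continuous_on UNIV f'"
     "\<forall>t. (g has_vector_derivative g' t) (at t)" "continuous_on UNIV g'"
    using assms unfolding C1_def by metis
  then show ?thesis unfolding C1_def using C1_continuous[OF assms(1)] C1_continuous[OF assms(2)]
    by (intro exI[of _ "\<lambda>t. f t * g' t + f' t * g t"] conjI allI has_vector_derivative_mult
         continuous_on_add continuous_on_mult) auto
qed

lemma C1_cnj:
  assumes "C1 f" shows "C1 (\<lambda>t. cnj (f t))"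
proof -
  obtain f' where "\<forall>t. (f has_vector_derivative f' t) (at t)" "continuous_on UNIV f'"
    using assms unfolding C1_def by metis
  then show ?thesis unfolding C1_def
    by (intro exI[of _ "\<lambda>t. cnj (f' t)"] conjI allI has_vector_derivative_cnj continuous_on_cnj) auto
qed

lemma C1_exp:
  assumes "C1 f" shows "C1 (\<lambda>t. exp (f t))"
proof -
  obtain f' where f': "\<forall>t. (f has_vector_derivative f' t) (at t)" "continuous_on UNIV f'"
    using assms unfolding C1_def by metis
  have "((\<lambda>t. exp (f t)) has_vector_derivative f' t * exp (f t)) (at t)" for t
    using field_vector_diff_chain_at[of f "f' t" t exp "exp (f t)"] f'(1) DERIV_exp
    by (auto simp: o_def)
  then show ?thesis unfolding C1_def using f'(2) C1_continuous[OF assms]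
    by (intro exI[of _ "\<lambda>t. f' t * exp (f t)"] conjI allI continuous_on_mult continuous_on_exp) auto
qed

lemma C1_poly_cis: "C1 (\<lambda>t. poly q (cis t))"
proof -
  have "((\<lambda>t. poly q (cis t)) has_vector_derivative (\<i> * cis t) * poly (pderiv q) (cis t)) (at t)" for t
    using field_vector_diff_chain_at[of cis "\<i> * cis t" t "poly q" "poly (pderiv q) (cis t)"]
      has_vector_derivative_cis_mult[of 1 t UNIV] poly_DERIV[of q "cis t"]
    by (simp add: o_def)
  then show ?thesis unfolding C1_def
    by (intro exI[of _ "\<lambda>t. (\<i> * cis t) * poly (pderiv q) (cis t)"] conjI allI)
       (auto intro!: continuous_intros)
qed

lemma C1_wiener:
  assumes "C1 F" "periodic_2pi F"
  shows "summable (\<lambda>j. cmod (fcoeff F (int j)))" "summable (\<lambda>j. cmod (fcoeff F (- int j)))"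
    "F t = (\<Sum>j. fcoeff F (int j) * cis (real j * t))
             + (\<Sum>j. fcoeff F (- int (Suc j)) * cis (- (real (Suc j) * t)))"
  using assms fourier_series_C1[of F] unfolding C1_def by blast+

text \<open>The frequencies from \<open>n\<close> on are collected into \<open>P\<close> after
  extracting \<open>cis (real n * t)\<close>. The negative ones form the conjugate of an analytic
  function; the factor \<open>cis t\<close> in front of \<open>M\<close> records that this function
  vanishes at 0.\<close>

lemma C1_split:
  assumes C1: "C1 F" and per: "periodic_2pi F"
    and zero: "\<And>j. j < n \<Longrightarrow> fcoeff F (int j) = 0"
  obtains P M where "disc_alg P" "disc_alg M"
    "\<And>t. F t = cis (real n * t) * P (cis t) + cnj (cis t * M (cis t))"
proof -
  note w = C1_wiener[OF C1 per]
  define P where "P = (\<lambda>z. \<Sum>j. fcoeff F (int (j + n)) * z ^ j)"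
  define M where "M = (\<lambda>z. \<Sum>j. cnj (fcoeff F (- int (Suc j))) * z ^ j)"
  have sp: "summable (\<lambda>j. cmod (fcoeff F (int (j + n))))"
    using w(1) summable_iff_shift[of "\<lambda>j. cmod (fcoeff F (int j))" n] by simp
  have sm: "summable (\<lambda>j. cmod (cnj (fcoeff F (- int (Suc j)))))"
    using w(2) summable_Suc_iff[of "\<lambda>j. cmod (fcoeff F (- int j))"] by simp
  have "disc_alg P" "disc_alg M"
    unfolding P_def M_def by (intro disc_alg_series sp sm)+
  moreover have "F t = cis (real n * t) * P (cis t) + cnj (cis t * M (cis t))" for t
  proof -
    have s: "summable (\<lambda>j. fcoeff F (int j) * cis (real j * t))"
      by (rule summable_norm_cancel) (simp add: norm_mult w(1))
    have s': "summable (\<lambda>j. fcoeff F (int (j + n)) * cis t ^ j)"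
      by (rule summable_norm_cancel) (use sp in \<open>simp add: norm_mult norm_power\<close>)
    have sm': "summable (\<lambda>j. cnj (fcoeff F (- int (Suc j))) * cis t ^ j)"
      by (rule summable_norm_cancel) (use sm in \<open>simp add: norm_mult norm_power\<close>)
    have "(\<Sum>j. fcoeff F (int j) * cis (real j * t))
        = (\<Sum>j. fcoeff F (int (j + n)) * cis (real (j + n) * t)) + (\<Sum>j<n. fcoeff F (int j) * cis (real j * t))"
      by (rule suminf_split_initial_segment[OF s])
    also have "(\<Sum>j<n. fcoeff F (int j) * cis (real j * t)) = 0"
      by (simp add: zero)
    also have "(\<Sum>j. fcoeff F (int (j + n)) * cis (real (j + n) * t)) = (\<Sum>j. cis (real n * t) * (fcoeff F (int (j + n)) * cis t ^ j))"
    proof (rule suminf_cong)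
      fix j
      have "cis (real (j + n) * t) = cis (real n * t) * cis t ^ j"
        unfolding Complex.DeMoivre cis_mult by (simp add: algebra_simps)
      then show "fcoeff F (int (j + n)) * cis (real (j + n) * t) = cis (real n * t) * (fcoeff F (int (j + n)) * cis t ^ j)"
        by simp
    qed
    also have "\<dots> = cis (real n * t) * P (cis t)"
      unfolding P_def by (rule suminf_mult[OF s'])
    finally have A: "(\<Sum>j. fcoeff F (int j) * cis (real j * t)) = cis (real n * t) * P (cis t)"
      by simp
    have "cnj (cis t * M (cis t)) = cnj (\<Sum>j. cis t * (cnj (fcoeff F (- int (Suc j))) * cis t ^ j))"
      unfolding M_def suminf_mult[OF sm'] ..
    also have "\<dots> = (\<Sum>j. cnj (cis t * (cnj (fcoeff F (- int (Suc j))) * cis t ^ j)))"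
      using bounded_linear.suminf[OF bounded_linear_cnj summable_mult[OF sm', of "cis t"]] by simp
    also have "\<dots> = (\<Sum>j. fcoeff F (- int (Suc j)) * cis (- (real (Suc j) * t)))"
    proof (rule suminf_cong)
      fix j
      have "cis t * cis t ^ j = cis (real (Suc j) * t)"
        using Complex.DeMoivre[of t "Suc j"] by simp
      then have "cnj (cis t * cis t ^ j) = cis (- (real (Suc j) * t))"
        by (simp only: cis_cnj)
      then show "cnj (cis t * (cnj (fcoeff F (- int (Suc j))) * cis t ^ j)) = fcoeff F (- int (Suc j)) * cis (- (real (Suc j) * t))"
        by (simp add: mult_ac)
    qed
    finally show ?thesis using A w(3)[of t] by simp
  qed
  ultimately show ?thesis using that by blast
qed

section \<open>The defect is controlled by the nonpositive frequencies of the oscillating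
  factor\<close>

text \<open>Let \<open>x\<close>, \<open>y\<close>, \<open>r\<close> be the mean squares of
  \<open>f\<close>, \<open>B\<close> and \<open>R\<close> on the circle. Since the analytic cross
  terms have mean 0, smallness of \<open>R\<close> gives \<open>y \<le> 2 * x\<close>. Since
  \<open>x\<close> is also the mean of \<open>f\<close>, it equals the mean of
  \<open>R t * b t\<close>, so \<open>x \<le> r + y / 4 \<le> r + x / 2\<close>.\<close>

lemma defect_bound:
  fixes f U R :: "real \<Rightarrow> complex"
  assumes A: "disc_alg A" "A 0 = 0" and B: "disc_alg B" and H: "disc_alg H" "H 0 = 0"
    and R: "continuous_on UNIV R" "\<And>t. cmod (R t) \<le> 1 / 2"
    and U: "\<And>t. cmod (U t) = 1" "\<And>t. U t = H (cis t) + R t"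
    and f: "\<And>t. f t = cnj (A (cis t)) + U t * B (cis t)"
    and mf: "mean f = complex_of_real (mean (\<lambda>t. (cmod (f t))\<^sup>2))"
  shows "mean (\<lambda>t. (cmod (f t))\<^sup>2) \<le> 2 * mean (\<lambda>t. (cmod (R t))\<^sup>2)"
proof -
  define a where "a = (\<lambda>t. A (cis t))"
  define b where "b = (\<lambda>t. B (cis t))"
  define h where "h = (\<lambda>t. H (cis t))"
  have ca: "cont_circle a" and cb: "cont_circle b" and ch: "cont_circle h"
    unfolding a_def b_def h_def by (intro disc_alg_continuous A B H)+
  have cR: "cont_circle R" using R(1) continuous_on_subset by blast
  have feq: "f t = cnj (a t) + (h t + R t) * b t" for t
    using f U(2) by (simp add: a_def b_def h_def)
  note cont = ca cb ch cR
  define x where "x = mean (\<lambda>t. (cmod (f t))\<^sup>2)"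
  define y where "y = mean (\<lambda>t. (cmod (b t))\<^sup>2)"
  define r where "r = mean (\<lambda>t. (cmod (R t))\<^sup>2)"
  have z1: "mean (\<lambda>t. a t * h t * b t) = 0"
    using mean_disc_alg[of "\<lambda>z. A z * H z * B z"] A H B
    by (simp add: a_def h_def b_def disc_alg_mult)
  have z2: "mean (\<lambda>t. h t * b t) = 0"
    using mean_disc_alg[of "\<lambda>z. H z * B z"] H B by (simp add: h_def b_def disc_alg_mult)
  have z3: "mean (\<lambda>t. cnj (a t)) = 0"
    using mean_disc_alg[OF A(1)] A(2) by (simp add: mean_cnj ca) (simp add: a_def)
  \<comment> \<open>As \<open>U\<close> is unimodular, \<open>\<bar>f\<bar>\<close> squared is the
    sum of the squares of \<open>a\<close> and \<open>b\<close> plus a cross term. The part of the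
    cross term with \<open>h\<close> has mean 0, and the part with \<open>R\<close> absorbs at most
    half of the two squares.\<close>
  have low: "y \<le> 2 * x"
  proof -
    have sq: "(cmod (f t))\<^sup>2 = (cmod (a t))\<^sup>2 + (cmod (b t))\<^sup>2 + 2 * Re (a t * h t * b t) + 2 * Re (a t * R t * b t)" for t
    proof -
      have "cmod (h t + R t) = 1" using U by (simp add: h_def)
      then have "cmod ((h t + R t) * b t) = cmod (b t)" by (simp add: norm_mult)
      moreover have "(cmod (f t))\<^sup>2 = (cmod (cnj (a t)))\<^sup>2 + (cmod ((h t + R t) * b t))\<^sup>2 + 2 * Re (a t * ((h t + R t) * b t))"
        using cmod_diff_square[of "(h t + R t) * b t" "- cnj (a t)"] unfolding feq
        by (simp add: algebra_simps)
      ultimately show ?thesis by (simp add: algebra_simps)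
    qed
    have "(cmod (a t))\<^sup>2 / 2 + (cmod (b t))\<^sup>2 / 2 + 2 * Re (a t * h t * b t) \<le> (cmod (f t))\<^sup>2" for t
    proof -
      have "cmod (a t * R t * b t) \<le> cmod (a t) * (1 / 2) * cmod (b t)"
        unfolding norm_mult using R(2)[of t] by (intro mult_mono) auto
      moreover have "cmod (a t) * cmod (b t) \<le> ((cmod (a t))\<^sup>2 + (cmod (b t))\<^sup>2) / 2"
        using sum_squares_bound[of "cmod (a t)" "cmod (b t)"] by simp
      ultimately show ?thesis
        using abs_Re_le_cmod[of "a t * R t * b t"] unfolding sq by (simp add: abs_le_iff)
    qed
    then have "(cmod (b t))\<^sup>2 / 2 + 2 * Re (a t * h t * b t) \<le> (cmod (f t))\<^sup>2" for t
      by (smt (verit) zero_le_power2 field_sum_of_halves)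
    then have "mean (\<lambda>t. (1/2) * (cmod (b t))\<^sup>2 + 2 * Re (a t * h t * b t)) \<le> x"
      unfolding x_def by (intro mean_mono) (auto simp: feq intro!: continuous_intros cont)
    also have "mean (\<lambda>t. (1/2) * (cmod (b t))\<^sup>2 + 2 * Re (a t * h t * b t))
        = (1/2) * y + 2 * Re (mean (\<lambda>t. a t * h t * b t))"
      unfolding y_def
      by (subst mean_Re[symmetric], (intro continuous_intros cont)+, subst mean_add)
         ((intro continuous_intros cont)+, simp only: mean_rmult)
    finally show ?thesis by (simp add: z1)
  qed
  have "mean f = mean (\<lambda>t. cnj (a t) + (h t * b t + R t * b t))"
    by (rule arg_cong[where f = mean]) (simp add: feq fun_eq_iff algebra_simps)
  also have "\<dots> = mean (\<lambda>t. cnj (a t)) + (mean (\<lambda>t. h t * b t) + mean (\<lambda>t. R t * b t))"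
    by (subst mean_add mean_add, (intro continuous_intros cont)+)+ simp
  finally have "complex_of_real x = mean (\<lambda>t. R t * b t)"
    using mf by (simp add: z2 z3 x_def)
  then have "x \<le> cmod (mean (\<lambda>t. R t * b t))"
    by (metis abs_ge_self norm_of_real)
  \<comment> \<open>The weight \<open>1 / 4\<close> is small enough for \<open>y \<le> 2 * x\<close>
    to leave half of \<open>x\<close> on the left.\<close>
  also have "\<dots> \<le> mean (\<lambda>t. (cmod (R t))\<^sup>2 + (1 / 4) * (cmod (b t))\<^sup>2)"
  proof (rule mean_norm_le)
    fix t show "cmod (R t * b t) \<le> (cmod (R t))\<^sup>2 + (1 / 4) * (cmod (b t))\<^sup>2"
      using zero_le_power2[of "cmod (R t) - cmod (b t) / 2"]
      by (simp add: norm_mult power2_eq_square algebra_simps)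
  qed (intro continuous_intros cont)+
  also have "\<dots> = r + (1 / 4) * y"
    unfolding r_def y_def
    by (subst mean_add, (intro continuous_intros cont)+, simp only: mean_rmult)
  finally show ?thesis using low by (simp add: x_def r_def)
qed

text \<open>Here \<open>G\<close> is the analytic part of the potential, and the functions
  \<open>A\<close> and \<open>B\<close> built in the proof are the analytic components of
  \<open>f\<close> required by \<open>defect_bound\<close>. The two evaluations \<open>mf\<close>
  and \<open>mff\<close> show that the quantity to be estimated is the squared norm of
  \<open>f\<close>.\<close>

lemma leading_coeff_defect:
  fixes V :: "real \<Rightarrow> real"
  assumes n: "n \<ge> 1"
    and orth: "orthonormal_polys (\<lambda>t. exp (- real n * V t)) p"
    and G: "disc_alg G" "G 0 = 0" "C1 (\<lambda>t. G (cis t))"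
    and V: "\<And>t. V t = v0 + 2 * Re (G (cis t))"
    and U: "\<And>t. cis (real n * (t - 2 * Im (G (cis t)))) = H (cis t) + R t"
    and H: "disc_alg H" "H 0 = 0"
    and R: "continuous_on UNIV R" "\<And>t. cmod (R t) \<le> 1 / 2"
  shows "\<bar>(Re (lead_coeff (p (n - 1))))\<^sup>2 * exp (- real n * v0) - 1\<bar> \<le> 2 * mean (\<lambda>t. (cmod (R t))\<^sup>2)"
proof -
  define m where "m = n - 1"
  define P where "P = p m"
  define \<gamma> where "\<gamma> = Re (lead_coeff P)"
  define E where "E = exp (- real n * v0)"
  define \<phi> where "\<phi> = (\<lambda>t. exp (- real n * V t))"
  define g where "g = (\<lambda>t. exp (- of_nat n * G (cis t)))"
  define q where "q = (\<lambda>t. cis (real m * t) * cnj (poly P (cis t)))"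
  \<comment> \<open>The reversed polynomial, that is, the analytic extension of \<open>q\<close> to
    the disc. Its value at 0 is the conjugate of the leading coefficient of \<open>P\<close>, hence
    \<gamma>.\<close>
  define Q where "Q = (\<lambda>z. \<Sum>j\<le>m. cnj (coeff P j) * z ^ (m - j))"
  define f where "f = (\<lambda>t. 1 - of_real (\<gamma> * E) * (q t * g t))"
  note orth = orth[folded \<phi>_def]
  have degP: "degree P = m" and \<gamma>pos: "\<gamma> > 0"
    using orth unfolding orthonormal_polys_def P_def \<gamma>_def by blast+
  have norm1: "inner_w \<phi> P P = 1"
    using orth unfolding orthonormal_polys_def P_def by simp
  have coeffP: "coeff P m = of_real \<gamma>"
    using orthonormal_polys_lead_coeff(1)[OF orth, of m] degP unfolding P_def \<gamma>_def by simp
  have C1g: "C1 g" unfolding g_def by (intro C1_exp C1_mult C1_const G)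
  have C1q: "C1 q" unfolding q_def by (intro C1_mult C1_cis C1_cnj C1_poly_cis)
  have C1f: "C1 f" unfolding f_def by (intro C1_diff C1_mult C1_const C1q C1g)
  note cont = C1_continuous[OF C1g] C1_continuous[OF C1q] C1_continuous[OF C1f]
  have Vfun: "V = (\<lambda>t. v0 + 2 * Re (G (cis t)))" using V by auto
  have cont\<phi>: "cont_circle \<phi>"
    unfolding \<phi>_def Vfun by (intro continuous_intros disc_alg_continuous G)
  have \<phi>g: "complex_of_real (\<phi> t) = of_real E * (g t * cnj (g t))" for t
  proof -
    have "\<phi> t = E * (cmod (g t))\<^sup>2"
      by (simp add: \<phi>_def E_def g_def V power2_eq_square exp_add[symmetric] algebra_simps)
    then show ?thesis by (simp add: of_real_cmod_square)
  qed
  have disc_Q: "disc_alg Q" unfolding Q_def disc_alg_def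
    by (auto intro!: continuous_intros holomorphic_intros)
  have Q0: "Q 0 = of_real \<gamma>"
  proof -
    have "Q 0 = (\<Sum>j\<le>m. if j = m then of_real \<gamma> else 0)"
      unfolding Q_def by (intro sum.cong) (auto simp: coeffP)
    then show ?thesis by simp
  qed
  have qQ: "q t = Q (cis t)" for t
  proof -
    have "q t = (\<Sum>j\<le>m. cis (real m * t) * (cnj (coeff P j) * cnj (cis t) ^ j))"
      unfolding q_def poly_altdef degP by (simp add: sum_distrib_left)
    also have "\<dots> = Q (cis t)" unfolding Q_def
    proof (rule sum.cong)
      fix j assume "j \<in> {..m}"
      then have "cis (real m * t) * cnj (cis t) ^ j = cis t ^ (m - j)"
        unfolding cis_cnj Complex.DeMoivre cis_mult by (simp add: algebra_simps of_nat_diff)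
      then show "cis (real m * t) * (cnj (coeff P j) * cnj (cis t) ^ j) = cnj (coeff P j) * cis t ^ (m - j)"
        by (simp add: mult_ac)
    qed simp
    finally show ?thesis .
  qed
  have disc_g: "disc_alg (\<lambda>z. exp (- of_nat n * G z))" by (rule disc_alg_exp[OF G(1)])
  have mqg: "mean (\<lambda>t. q t * g t) = of_real \<gamma>"
    using mean_disc_alg[OF disc_alg_mult[OF disc_Q disc_g]] by (simp add: qQ g_def Q0 G)
  \<comment> \<open>On the circle \<open>E\<close> times the square of
    \<open>\<bar>q g\<bar>\<close> is the weight times the square of \<open>\<bar>P\<bar>\<close>,
    so this is the normalisation of \<open>P\<close>.\<close>
  have mqg2: "E * mean (\<lambda>t. (cmod (q t * g t))\<^sup>2) = 1"
  proof -
    have "complex_of_real (E * mean (\<lambda>t. (cmod (q t * g t))\<^sup>2)) = mean (\<lambda>t. of_real (E * (cmod (q t * g t))\<^sup>2))"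
      by (subst mean_of_real, (intro continuous_intros cont)+, simp only: mean_rmult)
    also have "\<dots> = inner_w \<phi> P P"
      unfolding inner_w_mean
    proof (rule arg_cong[where f = mean], rule ext)
      fix t
      have "complex_of_real (E * (cmod (q t * g t))\<^sup>2) = of_real E * ((q t * g t) * cnj (q t * g t))"
        by (simp add: of_real_cmod_square)
      moreover have "q t * cnj (q t) = poly P (cis t) * cnj (poly P (cis t))"
      proof -
        have "cmod (q t) = cmod (poly P (cis t))" by (simp add: q_def norm_mult)
        then show ?thesis by (metis of_real_cmod_square)
      qed
      ultimately show "complex_of_real (E * (cmod (q t * g t))\<^sup>2) = poly P (cis t) * cnj (poly P (cis t)) * complex_of_real (\<phi> t)"
        unfolding \<phi>g by (simp add: mult_ac) 
    qed
    finally show ?thesis unfolding norm1 by (metis of_real_eq_1_iff)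
  qed
  have mf: "mean f = of_real (1 - \<gamma>\<^sup>2 * E)"
  proof -
    have "mean f = mean (\<lambda>t. 1) - of_real (\<gamma> * E) * mean (\<lambda>t. q t * g t)"
      unfolding f_def by (subst mean_diff, (intro continuous_intros cont)+, simp only: mean_cmult)
    then show ?thesis unfolding mqg by (simp add: power2_eq_square mult_ac)
  qed
  have mff: "mean (\<lambda>t. (cmod (f t))\<^sup>2) = 1 - \<gamma>\<^sup>2 * E"
  proof -
    have "(cmod (f t))\<^sup>2 = 1 + (\<gamma> * E)\<^sup>2 * (cmod (q t * g t))\<^sup>2 - 2 * (\<gamma> * E) * Re (q t * g t)" for t
      using cmod_diff_square[of 1 "of_real (\<gamma> * E) * (q t * g t)"]
      by (simp add: f_def norm_mult power_mult_distrib abs_mult)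
    then have "mean (\<lambda>t. (cmod (f t))\<^sup>2) = mean (\<lambda>t. 1 + (\<gamma> * E)\<^sup>2 * (cmod (q t * g t))\<^sup>2 - 2 * (\<gamma> * E) * Re (q t * g t))"
      by simp
    also have "\<dots> = mean (\<lambda>t. 1 + (\<gamma> * E)\<^sup>2 * (cmod (q t * g t))\<^sup>2) - 2 * (\<gamma> * E) * Re (mean (\<lambda>t. q t * g t))"
      by (subst mean_diff, (intro continuous_intros cont)+, simp only: mean_rmult, subst mean_Re)
         (intro continuous_intros cont, rule refl)
    also have "mean (\<lambda>t. 1 + (\<gamma> * E)\<^sup>2 * (cmod (q t * g t))\<^sup>2) = 1 + (\<gamma> * E)\<^sup>2 * mean (\<lambda>t. (cmod (q t * g t))\<^sup>2)"
      by (subst mean_add, (intro continuous_intros cont)+, simp only: mean_rmult mean_const)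
    also have "(\<gamma> * E)\<^sup>2 * mean (\<lambda>t. (cmod (q t * g t))\<^sup>2) = \<gamma>\<^sup>2 * E * (E * mean (\<lambda>t. (cmod (q t * g t))\<^sup>2))"
      by (simp add: power2_eq_square mult_ac)
    finally show ?thesis unfolding mqg mqg2 by (simp add: power2_eq_square mult_ac)
  qed
  define F where "F = (\<lambda>t. f t * cnj (g t))"
  have C1F: "C1 F" unfolding F_def by (intro C1_mult C1_cnj C1f C1g)
  have perF: "periodic_2pi F"
    unfolding periodic_2pi_def F_def f_def qQ g_def by (simp add: cis_mult[symmetric])
  \<comment> \<open>The coefficient has two contributions. Analyticity of \<open>g\<close> turns the
    first into the mean of a function with value 1 or 0 at the origin. The second is a pairing of
    \<open>P\<close> with the monomial of degree \<open>m - j\<close>, where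
    \<open>j \<le> m\<close> because \<open>m = n - 1\<close>. Both vanish for \<open>j > 0\<close>,
    and for \<open>j = 0\<close> they cancel.\<close>
  have "fcoeff F (int j) = 0" if j: "j < n" for j
  proof -
    have c1: "mean (\<lambda>t. cnj (g t * cis (real j * t))) = (if j = 0 then 1 else 0)"
    proof -
      have "mean (\<lambda>t. g t * cis (real j * t)) = (if j = 0 then 1 else 0)"
        using mean_disc_alg[OF disc_alg_mult[OF disc_g disc_alg_power[of j]]]
        by (simp add: g_def Complex.DeMoivre G power_0_left)
      then show ?thesis by (subst mean_cnj) (auto intro!: continuous_intros cont)
    qed
    have c2: "mean (\<lambda>t. cnj (poly P (cis t) * cnj (poly (monom 1 (m - j)) (cis t)) * of_real (\<phi> t)))
        = (if j = 0 then 1 / of_real \<gamma> else 0)"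
    proof -
      have "inner_w \<phi> P (monom 1 (m - j)) = cnj (coeff (monom 1 (m - j)) m) / of_real \<gamma>"
        unfolding P_def \<gamma>_def by (rule inner_w_lead_coeff[OF orth cont\<phi>]) (simp add: degree_monom_eq)
      also have "\<dots> = (if j = 0 then 1 / of_real \<gamma> else 0)"
        using j n by (auto simp: m_def)
      finally show ?thesis unfolding inner_w_mean
        by (subst mean_cnj) (auto intro!: continuous_intros cont\<phi>)
    qed
    have "fcoeff F (int j) = mean (\<lambda>t. cnj (g t * cis (real j * t)) - of_real \<gamma> *
        cnj (poly P (cis t) * cnj (poly (monom 1 (m - j)) (cis t)) * of_real (\<phi> t)))"
      unfolding fcoeff_def
    proof (rule arg_cong[where f = mean], rule ext)
      fix t
      have "cis (real m * t) * cis (- (real j * t)) = cis t ^ (m - j)"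
        using j unfolding Complex.DeMoivre cis_mult by (simp add: algebra_simps of_nat_diff m_def)
      then have "q t * cis (- (real j * t)) = cnj (poly P (cis t)) * poly (monom 1 (m - j)) (cis t)"
        by (simp add: q_def poly_monom mult_ac)
      moreover have "F t * cis (- (of_int (int j) * t)) =
         cnj (g t * cis (real j * t)) - of_real \<gamma> * ((q t * cis (- (real j * t))) * (of_real E * (g t * cnj (g t))))"
        by (simp add: F_def f_def cis_cnj algebra_simps)
      ultimately show "F t * cis (- (of_int (int j) * t)) = cnj (g t * cis (real j * t)) - of_real \<gamma> *
        cnj (poly P (cis t) * cnj (poly (monom 1 (m - j)) (cis t)) * of_real (\<phi> t))"
        unfolding \<phi>g by (simp add: mult_ac)
    qed
    also have "\<dots> = (if j = 0 then 1 else 0) - of_real \<gamma> * (if j = 0 then 1 / of_real \<gamma> else 0)"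
      by (subst mean_diff, (intro continuous_intros cont cont\<phi>)+, simp only: mean_cmult c1 c2)
    finally show ?thesis using \<gamma>pos by simp
  qed
  then obtain Sp Sm where S: "disc_alg Sp" "disc_alg Sm"
    "\<And>t. F t = cis (real n * t) * Sp (cis t) + cnj (cis t * Sm (cis t))"
    using C1_split[OF C1F perF] by blast
  \<comment> \<open>Dividing \<open>F\<close> by \<open>cnj g\<close> amounts to multiplying by the
    exponential of \<open>n\<close> times the conjugate of \<open>G\<close>. The factor
    \<open>z ^ 1\<close>, which makes \<open>A\<close> vanish at 0, is written as a power to match
    \<open>disc_alg_power\<close>.\<close>
  define A where "A = (\<lambda>z. z ^ 1 * Sm z * exp (of_nat n * G z))"
  define B where "B = (\<lambda>z. Sp z * exp (of_nat n * G z))"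
  have fAB: "f t = cnj (A (cis t)) + cis (real n * (t - 2 * Im (G (cis t)))) * B (cis t)" for t
  proof -
    define w where "w = of_nat n * G (cis t)"
    have "cnj (g t) * exp (cnj w) = 1"
      unfolding g_def w_def by (simp add: exp_cnj mult_exp_exp)
    then have "f t = F t * exp (cnj w)"
      by (simp add: F_def mult.assoc)
    also have "\<dots> = cnj (A (cis t)) + cis (real n * t) * exp (cnj w) * Sp (cis t)"
      unfolding S(3) A_def w_def by (simp add: algebra_simps exp_cnj)
    \<comment> \<open>Trading \<open>exp (cnj w)\<close> for the analytic \<open>exp w\<close> costs
      a unimodular factor, which together with \<open>cis (real n * t)\<close> forms the oscillating
      factor \<open>U\<close>.\<close>
    also have "cis (real n * t) * exp (cnj w) = cis (real n * (t - 2 * Im (G (cis t)))) * exp w"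
    proof -
      have "cnj w = w + \<i> * of_real (- 2 * real n * Im (G (cis t)))"
        by (simp add: w_def complex_eq_iff)
      then have "exp (cnj w) = cis (- 2 * real n * Im (G (cis t))) * exp w"
        unfolding cis_conv_exp[of "- 2 * real n * Im (G (cis t))"] by (simp only: exp_add mult.commute)
      then have "cis (real n * t) * exp (cnj w) = cis (real n * t) * cis (- 2 * real n * Im (G (cis t))) * exp w"
        by (simp only: mult.assoc)
      moreover have "cis (real n * t) * cis (- 2 * real n * Im (G (cis t))) = cis (real n * (t - 2 * Im (G (cis t))))"
        unfolding cis_mult by (simp add: algebra_simps)
      ultimately show ?thesis by simp
    qed
    finally show ?thesis by (simp add: B_def w_def mult_ac)
  qed
  have "mean (\<lambda>t. (cmod (f t))\<^sup>2) \<le> 2 * mean (\<lambda>t. (cmod (R t))\<^sup>2)"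
  proof (rule defect_bound[OF _ _ _ H R _ U fAB])
    show "disc_alg A" "disc_alg B"
      unfolding A_def B_def by (intro disc_alg_mult disc_alg_power disc_alg_exp S G)+
    show "A 0 = 0" by (simp add: A_def)
    show "mean f = complex_of_real (mean (\<lambda>t. (cmod (f t))\<^sup>2))"
      unfolding mf mff ..
  qed simp
  moreover have "0 \<le> mean (\<lambda>t. (cmod (f t))\<^sup>2)"
    by (intro mean_nonneg continuous_intros cont) simp
  ultimately show ?thesis
    unfolding mff by (simp add: \<gamma>_def E_def P_def m_def)
qed

section \<open>The truncated oscillating factor\<close>

text \<open>For a primitive \<open>P\<close> of \<open>F\<close>, the increment of \<open>P\<close>
  over one period has derivative 0, since \<open>F\<close> is periodic. It is thus the same constant
  on every horizontal line, and it is the integral of \<open>F\<close> over a period.\<close>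

lemma mean_entire_shift:
  assumes hol: "F holomorphic_on UNIV" and per: "\<And>z. F (z + 2 * of_real pi) = F z"
  shows "mean (\<lambda>t. F (of_real t + c)) = mean (\<lambda>t. F (of_real t))"
proof -
  obtain P where P: "(P has_field_derivative F z) (at z)" for z
    using holomorphic_convex_primitive'[of UNIV F] hol by auto
  have I: "integral {-pi..pi} (\<lambda>t. F (of_real t + c)) = P (of_real pi + c) - P (of_real (-pi) + c)" for c
  proof (intro integral_unique fundamental_theorem_of_calculus)
    fix t
    have "((\<lambda>z. P (z + c)) has_field_derivative F (of_real t + c)) (at (of_real t))"
      using P DERIV_shift by blast
    then show "((\<lambda>t. P (of_real t + c)) has_vector_derivative F (of_real t + c)) (at t within {-pi..pi})"
      by (rule has_vector_derivative_real_field)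
  qed simp
  have "((\<lambda>z. P (z + 2 * of_real pi) - P z) has_field_derivative 0) (at z)" for z
  proof -
    have "((\<lambda>z. P (z + 2 * of_real pi)) has_field_derivative F (z + 2 * of_real pi)) (at z)"
      using P DERIV_shift by blast
    from DERIV_diff[OF this P] show ?thesis by (simp add: per)
  qed
  then obtain K where K: "P (z + 2 * of_real pi) - P z = K" for z
    using has_field_derivative_zero_constant[of UNIV "\<lambda>z. P (z + 2 * of_real pi) - P z"] by auto
  have "P (of_real pi + c) - P (of_real (-pi) + c) = K" for c
    using K[of "of_real (-pi) + c"] by (simp add: algebra_simps)
  from this[of c] this[of 0] I[of c] I[of 0] show ?thesis by (simp add: mean_def)
qed

text \<open>The product of \<open>F\<close> with \<open>exp (\<i> * of_nat m * z)\<close> is again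
  entire and periodic, so its mean does not depend on the height. The second factor has modulus
  \<open>exp (- (real m * y))\<close> at height \<open>y\<close>.\<close>

lemma fcoeff_entire_shift:
  assumes hol: "F holomorphic_on UNIV" and per: "\<And>z. F (z + 2 * of_real pi) = F z"
  shows "fcoeff (\<lambda>t. F (of_real t + \<i> * of_real y)) (- int m)
       = of_real (exp (real m * y)) * fcoeff (\<lambda>t. F (of_real t)) (- int m)"
proof -
  define W where "W = (\<lambda>z. F z * exp (\<i> * of_nat m * z))"
  have "W holomorphic_on UNIV" unfolding W_def by (intro holomorphic_intros hol)
  moreover have "W (z + 2 * of_real pi) = W z" for z
  proof -
    have "exp (\<i> * of_nat m * (z + 2 * of_real pi)) = exp (\<i> * of_nat m * z)"
      using exp_plus_2pin[of "\<i> * of_nat m * z" "int m"] by (simp add: algebra_simps)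
    then show ?thesis by (simp add: W_def per)
  qed
  ultimately have "mean (\<lambda>t. W (of_real t + \<i> * of_real y)) = mean (\<lambda>t. W (of_real t))"
    by (rule mean_entire_shift)
  moreover have "W (of_real t + \<i> * of_real y) = of_real (exp (- (real m * y))) * (F (of_real t + \<i> * of_real y) * cis (- (of_int (- int m) * t)))" for t
  proof -
    have "\<i> * of_nat m * (of_real t + \<i> * of_real y) = of_real (- (real m * y)) + \<i> * of_real (real m * t)"
      by (simp add: algebra_simps)
    then show ?thesis unfolding W_def by (simp only: exp_add exp_of_real cis_conv_exp) simp
  qed
  moreover have "W (of_real t) = F (of_real t) * cis (- (of_int (- int m) * t))" for t
    by (simp add: W_def cis_conv_exp mult.assoc)
  ultimately have "of_real (exp (- (real m * y))) * fcoeff (\<lambda>t. F (of_real t + \<i> * of_real y)) (- int m)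
     = fcoeff (\<lambda>t. F (of_real t)) (- int m)"
    unfolding fcoeff_def by (simp only: mean_cmult)
  then have "of_real (exp (real m * y)) * (of_real (exp (- (real m * y))) * fcoeff (\<lambda>t. F (of_real t + \<i> * of_real y)) (- int m))
     = of_real (exp (real m * y)) * fcoeff (\<lambda>t. F (of_real t)) (- int m)" by simp
  then show ?thesis by (simp add: exp_minus flip: mult.assoc of_real_mult)
qed

text \<open>Smallness of \<open>F\<close> on the line at height \<open>y\<close> is converted into
  exponential decay of the coefficients of frequency \<open>- int m\<close> on the real
  line.\<close>

lemma bessel_entire_shift:
  assumes hol: "F holomorphic_on UNIV" and per: "\<And>z. F (z + 2 * of_real pi) = F z"
  shows "(\<Sum>m<M. (exp (real m * y) * cmod (fcoeff (\<lambda>t. F (of_real t)) (- int m)))\<^sup>2)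
       \<le> mean (\<lambda>t. (cmod (F (of_real t + \<i> * of_real y)))\<^sup>2)"
proof -
  have contF: "continuous_on UNIV F" using hol by (rule holomorphic_on_imp_continuous_on)
  have "(\<Sum>m<M. (exp (real m * y) * cmod (fcoeff (\<lambda>t. F (of_real t)) (- int m)))\<^sup>2)
      = (\<Sum>m<M. (cmod (fcoeff (\<lambda>t. F (of_real t + \<i> * of_real y)) (- int m)))\<^sup>2)"
    by (simp add: fcoeff_entire_shift[OF assms] norm_mult)
  also have "\<dots> = (\<Sum>j\<in>(\<lambda>m. - int m) ` {..<M}. (cmod (fcoeff (\<lambda>t. F (of_real t + \<i> * of_real y)) j))\<^sup>2)"
    by (subst sum.reindex) (auto simp: inj_on_def)
  also have "\<dots> \<le> mean (\<lambda>t. (cmod (F (of_real t + \<i> * of_real y)))\<^sup>2)"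
    by (rule bessel) (auto intro!: continuous_on_compose2[OF contF] continuous_intros)
  finally show ?thesis .
qed

lemma exp_diff_bound:
  fixes a b :: complex
  assumes "Re a \<le> M" "Re b \<le> M"
  shows "cmod (exp a - exp b) \<le> exp M * cmod (a - b)"
proof (rule field_differentiable_bound[where S = "{z. Re z \<le> M}" and f' = exp])
  show "convex {z. Re z \<le> M}" by (rule convex_halfspace_Re_le)
qed (use assms in \<open>auto intro: has_field_derivative_at_within DERIV_exp\<close>)

text \<open>Follows from quadratic upper and linear lower bounds for both exponentials. It serves to
  compare a truncated phase at small height with its linearisation.\<close>

lemma sinh_linear_approx:
  fixes x :: real
  assumes "0 \<le> x" "x \<le> 1"
  shows "\<bar>(exp x - exp (- x)) / 2 - x\<bar> \<le> x\<^sup>2 / 2"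
proof -
  have "exp x \<le> 1 + x + x\<^sup>2" using assms by (rule exp_bound)
  moreover have "1 + x \<le> exp x" "1 - x \<le> exp (- x)"
    using exp_ge_add_one_self[of x] exp_ge_add_one_self[of "-x"] by simp_all
  moreover have "exp (- x) \<le> 1 - x + x\<^sup>2"
  proof -
    have "exp (- x) \<le> 1 / (1 + x)"
      using assms exp_ge_add_one_self[of x] by (simp add: exp_minus field_simps)
    also have "\<dots> \<le> 1 - x + x\<^sup>2"
      using assms by (simp add: field_simps power2_eq_square)
    finally show ?thesis .
  qed
  ultimately have "(exp x - exp (- x)) / 2 - x \<le> x\<^sup>2 / 2" "- ((exp x - exp (- x)) / 2 - x) \<le> x\<^sup>2 / 2"
    by argo+
  then show ?thesis by (rule abs_leI)
qed

text \<open>A geometric series with ratio \<open>q = exp (- (2 * y))\<close>, for which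
  \<open>1 - q \<ge> 2 * y / (1 + 2 * y)\<close>.\<close>

lemma geometric_exp_bound:
  assumes "0 < y"
  shows "(\<Sum>m<M. (exp (- (real m * y)))\<^sup>2) \<le> 1 + 1 / (2 * y)"
proof -
  define q where "q = exp (- (2 * y))"
  have q: "0 < q" "q < 1" using assms by (auto simp: q_def)
  have "(\<Sum>m<M. (exp (- (real m * y)))\<^sup>2) = (\<Sum>m<M. q ^ m)"
    by (rule sum.cong) (simp_all add: q_def power2_eq_square mult_exp_exp algebra_simps flip: exp_of_nat_mult)
  also have "\<dots> \<le> (\<Sum>m. q ^ m)"
    using q by (intro sum_le_suminf summable_geometric) auto
  also have "\<dots> = 1 / (1 - q)" using q by (intro suminf_geometric) auto
  also have "\<dots> \<le> 1 + 1 / (2 * y)"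
  proof -
    have "q \<le> 1 / (1 + 2 * y)"
      using assms exp_ge_add_one_self[of "2 * y"] by (simp add: q_def exp_minus field_simps)
    then have "2 * y / (1 + 2 * y) \<le> 1 - q" using assms by (simp add: field_simps)
    then have "1 / (1 - q) \<le> 1 / (2 * y / (1 + 2 * y))"
      using assms q by (intro divide_left_mono mult_pos_pos divide_pos_pos) auto
    also have "\<dots> = 1 + 1 / (2 * y)" using assms by (simp add: field_simps)
    finally show ?thesis .
  qed
  finally show ?thesis .
qed

lemma L2_set_sum_triangle:
  assumes "finite I"
  shows "L2_set (\<lambda>m. cmod (\<Sum>i\<in>I. d i m)) A \<le> (\<Sum>i\<in>I. L2_set (\<lambda>m. cmod (d i m)) A)"
  using assms
proof induction
  case (insert i I)
  have "L2_set (\<lambda>m. cmod (\<Sum>i\<in>insert i I. d i m)) A \<le> L2_set (\<lambda>m. cmod (d i m) + cmod (\<Sum>i\<in>I. d i m)) A"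
    using insert.hyps by (intro L2_set_mono) (auto intro: norm_triangle_ineq)
  also have "\<dots> \<le> L2_set (\<lambda>m. cmod (d i m)) A + L2_set (\<lambda>m. cmod (\<Sum>i\<in>I. d i m)) A"
    by (rule L2_set_triangle_ineq)
  finally show ?case using insert by simp
qed (simp add: L2_set_def)

lemma has_vector_derivative_series:
  fixes f :: "nat \<Rightarrow> real \<Rightarrow> 'a::banach"
  assumes der: "\<And>n x. (f n has_vector_derivative f' n x) (at x)"
    and unif: "uniform_limit UNIV (\<lambda>n x. \<Sum>i<n. f' i x) g' sequentially"
    and summ: "\<And>x. summable (\<lambda>n. f n x)"
  shows "((\<lambda>x. \<Sum>n. f n x) has_vector_derivative g' x) (at x)"
proof -
  have "\<exists>g. \<forall>x\<in>UNIV. (\<lambda>n. f n x) sums g x \<and> (g has_derivative (\<lambda>h. h *\<^sub>R g' x)) (at x within UNIV)"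
  proof (rule has_derivative_series[where f' = "\<lambda>n x h. h *\<^sub>R f' n x"])
    fix e :: real assume "e > 0"
    with unif have "\<forall>\<^sub>F n in sequentially. \<forall>x\<in>UNIV. dist (\<Sum>i<n. f' i x) (g' x) < e"
      by (simp add: uniform_limit_iff)
    then show "\<forall>\<^sub>F n in sequentially. \<forall>x\<in>UNIV. \<forall>h. norm ((\<Sum>i<n. h *\<^sub>R f' i x) - h *\<^sub>R g' x) \<le> e * norm h"
    proof eventually_elim
      case (elim n)
      show ?case
      proof (intro ballI allI)
        fix x h :: real
        have "norm ((\<Sum>i<n. h *\<^sub>R f' i x) - h *\<^sub>R g' x) = \<bar>h\<bar> * dist (\<Sum>i<n. f' i x) (g' x)"
          by (simp add: dist_norm flip: scaleR_sum_right scaleR_diff_right)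
        also have "\<dots> \<le> \<bar>h\<bar> * e" using elim by (intro mult_left_mono) (auto intro: less_imp_le)
        finally show "norm ((\<Sum>i<n. h *\<^sub>R f' i x) - h *\<^sub>R g' x) \<le> e * norm h" by (simp add: mult.commute)
      qed
    qed
  qed (use der summ[of 0] in \<open>auto simp: has_vector_derivative_def intro: summable_sums\<close>)
  then obtain g where g: "\<And>x. (\<lambda>n. f n x) sums g x" "\<And>x. (g has_derivative (\<lambda>h. h *\<^sub>R g' x)) (at x)"
    by auto
  have "g = (\<lambda>x. \<Sum>n. f n x)" using g(1) by (auto simp: sums_iff)
  with g(2) show ?thesis by (simp add: has_vector_derivative_def)
qed

section \<open>The analytic part of the potential and the truncated phases\<close>

locale circle_series =
  fixes \<alpha> :: "nat \<Rightarrow> complex" and S :: real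
  assumes \<alpha>0: "\<alpha> 0 = 0"
    and S: "\<And>J. (\<Sum>j\<le>J. real j * cmod (\<alpha> j)) \<le> S"
begin

definition G :: "complex \<Rightarrow> complex" where
  "G z = (\<Sum>j. \<alpha> j * z ^ j)"

lemma summable_j\<alpha>: "summable (\<lambda>j. real j * cmod (\<alpha> j))"
proof (rule summableI_nonneg_bounded)
  fix n show "(\<Sum>i<n. real i * cmod (\<alpha> i)) \<le> S"
    by (rule order_trans[OF sum_mono2 S[of n]]) auto
qed simp

lemma summable_\<alpha>: "summable (\<lambda>j. cmod (\<alpha> j))"
  by (rule summable_comparison_test'[OF summable_j\<alpha>, of 1]) (auto simp: mult_le_cancel_right1)

lemma disc_alg_G: "disc_alg G"
  unfolding G_def by (rule disc_alg_series[OF summable_\<alpha>])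

lemma G_0: "G 0 = 0"
  unfolding G_def by (subst suminf_finite[of "{0}"]) (auto simp: \<alpha>0)

lemma G_cis: "G (cis t) = (\<Sum>j. \<alpha> j * cis (real j * t))"
  unfolding G_def by (simp add: Complex.DeMoivre)

text \<open>Termwise differentiation; the differentiated series is dominated by the summable
  \<open>real j * cmod (\<alpha> j)\<close>.\<close>

lemma G_deriv:
  "((\<lambda>t. G (cis t)) has_vector_derivative (\<Sum>j. \<alpha> j * (\<i> * of_real (real j) * cis (real j * t)))) (at t)"
  "continuous_on UNIV (\<lambda>t. \<Sum>j. \<alpha> j * (\<i> * of_real (real j) * cis (real j * t)))"
proof -
  have unif: "uniform_limit UNIV (\<lambda>n t. \<Sum>j<n. \<alpha> j * (\<i> * of_real (real j) * cis (real j * t)))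
      (\<lambda>t. \<Sum>j. \<alpha> j * (\<i> * of_real (real j) * cis (real j * t))) sequentially"
    by (rule Weierstrass_m_test[OF _ summable_j\<alpha>]) (simp add: norm_mult mult.commute)
  show "((\<lambda>t. G (cis t)) has_vector_derivative (\<Sum>j. \<alpha> j * (\<i> * of_real (real j) * cis (real j * t)))) (at t)"
    unfolding G_cis
  proof (rule has_vector_derivative_series[OF _ unif])
    show "((\<lambda>t. \<alpha> n * cis (real n * t)) has_vector_derivative \<alpha> n * (\<i> * of_real (real n) * cis (real n * x))) (at x)" for n x
      by (intro has_vector_derivative_mult_right has_vector_derivative_cis_mult)
    show "summable (\<lambda>j. \<alpha> j * cis (real j * x))" for x
      by (rule summable_norm_cancel) (simp add: norm_mult summable_\<alpha>)
  qed
  show "continuous_on UNIV (\<lambda>t. \<Sum>j. \<alpha> j * (\<i> * of_real (real j) * cis (real j * t)))"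
    by (rule uniform_limit_theorem[OF _ unif]) (auto intro!: always_eventually continuous_intros)
qed

lemma C1_G: "C1 (\<lambda>t. G (cis t))"
  unfolding C1_def
  by (rule exI[of _ "\<lambda>t. \<Sum>j. \<alpha> j * (\<i> * of_real (real j) * cis (real j * t))"])
     (use G_deriv in auto)

end

text \<open>The bound \<open>B\<close> expresses that \<open>k\<close> derivatives are square
  integrable. The right side in \<open>pos\<close> is the derivative of the truncated phase, so the
  assumption says that all truncations from level \<open>2 ^ l0\<close> on are uniformly
  increasing.\<close>

locale circle_phase = circle_series +
  fixes k l0 :: nat and \<delta> B :: real
  assumes k: "k \<ge> 2" and \<delta>: "\<delta> > 0"
    and B: "\<And>J. (\<Sum>j\<le>J. (real j ^ k * cmod (\<alpha> j))\<^sup>2) \<le> B"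
    and pos: "\<And>N t. N \<ge> 2 ^ l0 \<Longrightarrow> \<delta> / 2 \<le> 1 - 2 * (\<Sum>j\<le>N. real j * Re (\<alpha> j * cis (real j * t)))"
begin

text \<open>The entire extension of the truncated \<kappa>: on the real line the two exponentials
  are conjugate, and \<open>\<i> * (w - cnj w)\<close> equals \<open>- 2 * Im w\<close>.\<close>

definition phase :: "nat \<Rightarrow> complex \<Rightarrow> complex" where
  "phase N z = z + \<i> * (\<Sum>j\<le>N. \<alpha> j * exp (\<i> * of_nat j * z) - cnj (\<alpha> j) * exp (- (\<i> * of_nat j * z)))"

definition wave :: "nat \<Rightarrow> nat \<Rightarrow> complex \<Rightarrow> complex" where
  "wave n N z = exp (\<i> * of_nat n * phase N z)"

lemma wave_holomorphic: "wave n N holomorphic_on A"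
  unfolding wave_def phase_def by (intro holomorphic_intros)

lemma wave_periodic: "wave n N (z + 2 * of_real pi) = wave n N z"
proof -
  have e: "exp (\<i> * of_nat j * (z + 2 * of_real pi)) = exp (\<i> * of_nat j * z)"
      "exp (- (\<i> * of_nat j * (z + 2 * of_real pi))) = exp (- (\<i> * of_nat j * z))" for j
    using exp_plus_2pin[of "\<i> * of_nat j * z" "int j"] exp_plus_2pin[of "- (\<i> * of_nat j * z)" "- int j"]
    by (simp_all add: algebra_simps)
  have "phase N (z + 2 * of_real pi) = phase N z + 2 * of_real pi"
    unfolding phase_def e by simp
  then show ?thesis
    using exp_plus_2pin[of "\<i> * of_nat n * phase N z" "int n"]
    by (simp add: wave_def algebra_simps)
qed

lemma exp_strip:
  "exp (\<i> * of_nat j * (of_real t + \<i> * of_real y)) = of_real (exp (- (real j * y))) * cis (real j * t)"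
  "exp (- (\<i> * of_nat j * (of_real t + \<i> * of_real y))) = of_real (exp (real j * y)) * cis (- (real j * t))"
proof -
  have *: "\<i> * of_nat j * (of_real t + \<i> * of_real y) = of_real (- (real j * y)) + \<i> * of_real (real j * t)"
    by (simp add: algebra_simps)
  show "exp (\<i> * of_nat j * (of_real t + \<i> * of_real y)) = of_real (exp (- (real j * y))) * cis (real j * t)"
    unfolding * by (simp only: exp_add exp_of_real cis_conv_exp)
  have *: "- (\<i> * of_nat j * (of_real t + \<i> * of_real y)) = of_real (real j * y) + \<i> * of_real (- (real j * t))"
    by (simp add: algebra_simps)
  show "exp (- (\<i> * of_nat j * (of_real t + \<i> * of_real y))) = of_real (exp (real j * y)) * cis (- (real j * t))"
    unfolding * by (simp only: exp_add exp_of_real cis_conv_exp)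
qed

lemma S_nonneg: "0 \<le> S" and B_nonneg: "0 \<le> B"
  using S[of 0] B[of 0] by (simp_all add: \<alpha>0)

text \<open>The height of a contour shift in units of the inverse truncation level. It is small
  enough for the nonlinear error in \<open>Im_phase\<close> to use up at most half of the available
  slope; \<open>S + 1\<close> keeps the denominator positive.\<close>

definition \<tau> :: real where "\<tau> = min (1 / 2) (\<delta> / (8 * (S + 1)))"

lemma \<tau>: "0 < \<tau>" "\<tau> \<le> 1 / 2" "2 * \<tau> * S \<le> \<delta> / 4"
proof -
  show "0 < \<tau>" "\<tau> \<le> 1 / 2" using \<delta> S_nonneg unfolding \<tau>_def by (simp, intro min.cobounded1)
  have "\<tau> * (8 * (S + 1)) \<le> \<delta> / (8 * (S + 1)) * (8 * (S + 1))"
    using S_nonneg by (intro mult_right_mono) (auto simp: \<tau>_def)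
  also have "\<dots> = \<delta>" using S_nonneg by simp
  finally have "8 * \<tau> * S + 8 * \<tau> \<le> \<delta>" by (simp add: algebra_simps)
  then show "2 * \<tau> * S \<le> \<delta> / 4" using \<open>0 < \<tau>\<close> by simp
qed

text \<open>The imaginary part is \<open>y\<close> minus a sum of terms
  \<open>2 * r j * sinh (j * y)\<close>. Linearising the hyperbolic sine gives \<open>y\<close>
  times the derivative of the truncated phase, at least \<open>y * \<delta> / 2\<close>. As
  \<open>j * y \<le> 2 * \<tau>\<close>, the quadratic error is at most
  \<open>y * (2 * \<tau> * S) \<le> y * \<delta> / 4\<close>.\<close>

lemma Im_phase:
  assumes N: "N \<ge> 2 ^ l0" and y: "0 \<le> y" "real N * y \<le> 2 * \<tau>"
  shows "y * \<delta> / 4 \<le> Im (phase N (of_real t + \<i> * of_real y))"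
proof -
  define s where "s = (\<lambda>x::real. (exp x - exp (- x)) / 2)"
  define r where "r = (\<lambda>j. Re (\<alpha> j * cis (real j * t)))"
  have "Im (phase N (of_real t + \<i> * of_real y)) = y - (\<Sum>j\<le>N. 2 * r j * s (real j * y))"
  proof -
    have "Re (\<alpha> j * exp (\<i> * of_nat j * (of_real t + \<i> * of_real y)) - cnj (\<alpha> j) * exp (- (\<i> * of_nat j * (of_real t + \<i> * of_real y))))
       = - (2 * r j * s (real j * y))" for j
      unfolding exp_strip r_def s_def by (simp add: field_simps)
    then show ?thesis unfolding phase_def by (simp add: sum_negf)
  qed
  also have "(\<Sum>j\<le>N. 2 * r j * s (real j * y)) = y * (2 * (\<Sum>j\<le>N. real j * r j)) + (\<Sum>j\<le>N. 2 * r j * (s (real j * y) - real j * y))"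
    unfolding sum_distrib_left sum.distrib[symmetric] by (rule sum.cong) (auto simp: algebra_simps)
  finally have eq: "Im (phase N (of_real t + \<i> * of_real y)) = y * (1 - 2 * (\<Sum>j\<le>N. real j * r j)) - (\<Sum>j\<le>N. 2 * r j * (s (real j * y) - real j * y))"
    by (simp add: algebra_simps)
  have "y * (\<delta> / 2) \<le> y * (1 - 2 * (\<Sum>j\<le>N. real j * r j))"
    using pos[OF N, of t] y(1) unfolding r_def by (rule mult_left_mono)
  moreover have "(\<Sum>j\<le>N. 2 * r j * (s (real j * y) - real j * y)) \<le> y * (\<delta> / 4)"
  proof -
    have "(\<Sum>j\<le>N. 2 * r j * (s (real j * y) - real j * y)) \<le> (\<Sum>j\<le>N. y * (2 * \<tau>) * (real j * cmod (\<alpha> j)))"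
    proof (rule sum_mono)
      fix j assume j: "j \<in> {..N}"
      then have jy: "real j * y \<le> 2 * \<tau>" "0 \<le> real j * y"
        using y by (auto intro!: order_trans[OF mult_right_mono y(2)])
      then have "\<bar>s (real j * y) - real j * y\<bar> \<le> (real j * y)\<^sup>2 / 2"
        unfolding s_def using \<tau> by (intro sinh_linear_approx) auto
      also have "\<dots> \<le> (real j * y) * (2 * \<tau>) / 2"
        using jy unfolding power2_eq_square by (intro divide_right_mono mult_left_mono) auto
      finally have s: "\<bar>s (real j * y) - real j * y\<bar> \<le> (real j * y) * (2 * \<tau>) / 2" .
      have r: "\<bar>r j\<bar> \<le> cmod (\<alpha> j)"
        using abs_Re_le_cmod[of "\<alpha> j * cis (real j * t)"] by (simp add: r_def norm_mult)
      have "2 * r j * (s (real j * y) - real j * y) \<le> 2 * (\<bar>r j\<bar> * \<bar>s (real j * y) - real j * y\<bar>)"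
        using abs_ge_self[of "r j * (s (real j * y) - real j * y)"] by (simp add: abs_mult)
      also have "\<dots> \<le> 2 * (cmod (\<alpha> j) * ((real j * y) * (2 * \<tau>) / 2))"
        using r s by (intro mult_left_mono mult_mono) auto
      finally show "2 * r j * (s (real j * y) - real j * y) \<le> y * (2 * \<tau>) * (real j * cmod (\<alpha> j))"
        by (simp add: mult_ac)
    qed
    also have "\<dots> = y * (2 * \<tau> * (\<Sum>j\<le>N. real j * cmod (\<alpha> j)))"
      by (simp add: sum_distrib_left mult_ac)
    also have "\<dots> \<le> y * (\<delta> / 4)"
      using \<tau> S[of N] y(1) by (intro mult_left_mono order_trans[OF mult_left_mono[OF S] \<tau>(3)]) auto
    finally show ?thesis .
  qed
  ultimately show ?thesis unfolding eq by simp
qed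

lemma Re_wave_exponent_le:
  assumes "N \<ge> 2 ^ l0" "0 \<le> y" "real N * y \<le> 2 * \<tau>"
  shows "Re (\<i> * of_nat n * phase N (of_real t + \<i> * of_real y)) \<le> - (real n * y * \<delta> / 4)"
  using mult_left_mono[OF Im_phase[OF assms, of t], of "real n"] by (simp add: mult_ac)

text \<open>Only frequencies between \<open>N\<close> and \<open>N'\<close> remain, so the weight
  \<open>j ^ k\<close> in the bound \<open>B\<close> gains the factor \<open>N ^ k\<close>, while
  all exponentials are at most \<open>exp 1\<close> at this height. The analytic and antianalytic
  halves are treated separately by Parseval, which accounts for the factor 4.\<close>

lemma phase_diff_mean:
  assumes N: "1 \<le> N" "N \<le> N'" and y: "0 \<le> y" "real N' * y \<le> 1"
  shows "mean (\<lambda>t. (cmod (phase N' (of_real t + \<i> * of_real y) - phase N (of_real t + \<i> * of_real y)))\<^sup>2)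
      \<le> 4 * (exp 2 * (B / (real N ^ k)\<^sup>2))"
proof -
  let ?J = "{N<..N'}"
  define u where "u = (\<lambda>t. \<Sum>j\<in>?J. (\<alpha> j * of_real (exp (- (real j * y)))) * cis (of_int (int j) * t))"
  define v where "v = (\<lambda>t. \<Sum>j\<in>?J. (cnj (\<alpha> j) * of_real (exp (real j * y))) * cis (of_int (- int j) * t))"
  have eq: "phase N' (of_real t + \<i> * of_real y) - phase N (of_real t + \<i> * of_real y) = \<i> * (u t - v t)" for t
  proof -
    have "{..N'} = {..N} \<union> ?J" using N by auto
    then have "(\<Sum>j\<le>N'. h j) = (\<Sum>j\<le>N. h j) + (\<Sum>j\<in>?J. h j)" for h :: "nat \<Rightarrow> complex"
      by (simp add: sum.union_disjoint ivl_disj_int)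
    then show ?thesis
      unfolding phase_def exp_strip u_def v_def by (simp add: sum_subtractf algebra_simps)
  qed
  have cu: "cont_circle u" and cv: "cont_circle v"
    unfolding u_def v_def by (intro continuous_intros)+
  have tail: "(\<Sum>j\<in>?J. (cmod (\<alpha> j) * e j)\<^sup>2) \<le> exp 2 * (B / (real N ^ k)\<^sup>2)"
    if e: "\<And>j. j \<in> ?J \<Longrightarrow> 0 \<le> e j \<and> e j \<le> exp 1" for e :: "nat \<Rightarrow> real"
  proof -
    have "(\<Sum>j\<in>?J. (cmod (\<alpha> j) * e j)\<^sup>2) \<le> (\<Sum>j\<in>?J. exp 2 / (real N ^ k)\<^sup>2 * (real j ^ k * cmod (\<alpha> j))\<^sup>2)"
    proof (rule sum_mono)
      fix j assume j: "j \<in> ?J"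
      have "real N ^ k * (cmod (\<alpha> j) * e j) \<le> real j ^ k * (cmod (\<alpha> j) * exp 1)"
        using j e[OF j] by (intro mult_mono power_mono) auto
      then have "(real N ^ k * (cmod (\<alpha> j) * e j))\<^sup>2 \<le> (real j ^ k * (cmod (\<alpha> j) * exp 1))\<^sup>2"
        using e[OF j] by (intro power_mono) auto
      also have "\<dots> = exp 2 * (real j ^ k * cmod (\<alpha> j))\<^sup>2"
        by (simp add: power_mult_distrib mult_ac exp_double[of 1, simplified])
      finally show "(cmod (\<alpha> j) * e j)\<^sup>2 \<le> exp 2 / (real N ^ k)\<^sup>2 * (real j ^ k * cmod (\<alpha> j))\<^sup>2"
        using N by (simp add: power_mult_distrib field_simps)
    qed
    also have "\<dots> = exp 2 / (real N ^ k)\<^sup>2 * (\<Sum>j\<in>?J. (real j ^ k * cmod (\<alpha> j))\<^sup>2)"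
      by (simp add: sum_distrib_left)
    also have "\<dots> \<le> exp 2 / (real N ^ k)\<^sup>2 * B"
      by (intro mult_left_mono order_trans[OF sum_mono2 B[of N']]) auto
    finally show ?thesis by simp
  qed
  have jy: "real j * y \<le> 1" if "j \<in> ?J" for j
    using that y by (intro order_trans[OF mult_right_mono y(2)]) auto
  have mu: "mean (\<lambda>t. (cmod (u t))\<^sup>2) \<le> exp 2 * (B / (real N ^ k)\<^sup>2)"
  proof -
    have "mean (\<lambda>t. (cmod (u t))\<^sup>2) = (\<Sum>j\<in>?J. (cmod (\<alpha> j * of_real (exp (- (real j * y)))))\<^sup>2)"
      unfolding u_def by (rule trig_poly_norm) (auto simp: inj_on_def)
    also have "\<dots> = (\<Sum>j\<in>?J. (cmod (\<alpha> j) * exp (- (real j * y)))\<^sup>2)"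
      by (simp add: norm_mult)
    also have "\<dots> \<le> exp 2 * (B / (real N ^ k)\<^sup>2)"
    proof (rule tail)
      fix j
      have "0 \<le> real j * y" using y by simp
      then show "0 \<le> exp (- (real j * y)) \<and> exp (- (real j * y)) \<le> exp 1" by simp
    qed
    finally show ?thesis .
  qed
  have mv: "mean (\<lambda>t. (cmod (v t))\<^sup>2) \<le> exp 2 * (B / (real N ^ k)\<^sup>2)"
  proof -
    have "mean (\<lambda>t. (cmod (v t))\<^sup>2) = (\<Sum>j\<in>?J. (cmod (cnj (\<alpha> j) * of_real (exp (real j * y))))\<^sup>2)"
      unfolding v_def by (rule trig_poly_norm) (auto simp: inj_on_def)
    also have "\<dots> = (\<Sum>j\<in>?J. (cmod (\<alpha> j) * exp (real j * y))\<^sup>2)"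
      by (simp add: norm_mult)
    also have "\<dots> \<le> exp 2 * (B / (real N ^ k)\<^sup>2)"
      by (rule tail) (use jy in simp)
    finally show ?thesis .
  qed
  have "mean (\<lambda>t. (cmod (\<i> * (u t - v t)))\<^sup>2) \<le> mean (\<lambda>t. 2 * (cmod (u t))\<^sup>2 + 2 * (cmod (v t))\<^sup>2)"
  proof (rule mean_mono)
    fix t
    have "(cmod (u t - v t))\<^sup>2 \<le> (cmod (u t) + cmod (v t))\<^sup>2"
      by (intro power_mono norm_triangle_ineq4) simp
    also have "\<dots> \<le> 2 * (cmod (u t))\<^sup>2 + 2 * (cmod (v t))\<^sup>2"
      using sum_squares_bound[of "cmod (u t)" "cmod (v t)"] by (simp add: power2_sum)
    finally show "(cmod (\<i> * (u t - v t)))\<^sup>2 \<le> 2 * (cmod (u t))\<^sup>2 + 2 * (cmod (v t))\<^sup>2"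
      by (simp add: norm_mult)
  qed (intro continuous_intros cu cv)+
  also have "\<dots> = 2 * mean (\<lambda>t. (cmod (u t))\<^sup>2) + 2 * mean (\<lambda>t. (cmod (v t))\<^sup>2)"
    by (subst mean_add, (intro continuous_intros cu cv)+, simp only: mean_rmult)
  also have "\<dots> \<le> 4 * (exp 2 * (B / (real N ^ k)\<^sup>2))"
  proof -
    have "2 * a + 2 * b \<le> 4 * c" if "a \<le> c" "b \<le> c" for a b c :: real
      using that by simp
    from this[OF mu mv] show ?thesis .
  qed
  finally show ?thesis unfolding eq .
qed

definition rate :: real where "rate = \<tau> * \<delta> / 4"

lemma rate_pos: "0 < rate"
  using \<tau> \<delta> by (simp add: rate_def)

text \<open>Shift the difference of two consecutive dyadic waves to height \<open>y\<close>. Both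
  exponents there have real part at most \<open>- (rate * real n / 2 ^ l)\<close>, so the difference
  of the waves is at most \<open>n\<close> times the resulting exponential times the difference of
  the phases.\<close>

lemma block_bound:
  assumes l: "l0 \<le> l"
  defines "y \<equiv> \<tau> / 2 ^ l"
  shows "(\<Sum>m<M. (exp (real m * y) * cmod (fcoeff (\<lambda>t. wave n (2 ^ Suc l) (of_real t) - wave n (2 ^ l) (of_real t)) (- int m)))\<^sup>2)
     \<le> (2 * exp 1 * sqrt B * (real n / (2 ^ l) ^ k * exp (- (rate * real n / 2 ^ l))))\<^sup>2"
proof -
  let ?N = "2 ^ l :: nat" and ?N' = "2 ^ Suc l :: nat"
  let ?z = "\<lambda>t. of_real t + \<i> * of_real y :: complex"
  \<comment> \<open>The finer level satisfies \<open>2 ^ Suc l * y = 2 * \<tau>\<close>, which is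
    why the height conditions are stated with \<open>2 * \<tau>\<close> and why
    \<open>\<tau> \<le> 1 / 2\<close> is wanted.\<close>
  have y: "0 \<le> y" "real ?N * y \<le> 2 * \<tau>" "real ?N' * y \<le> 2 * \<tau>" "real ?N' * y \<le> 1"
    using \<tau> by (simp_all add: y_def)
  have N: "?N \<ge> 2 ^ l0" "?N' \<ge> 2 ^ l0" using l by (simp_all add: power_increasing le_SucI del: power_Suc)
  have cont: "continuous_on A (\<lambda>t. phase N (?z t))" "continuous_on A (\<lambda>t. wave n N (?z t))" for N A
    unfolding wave_def phase_def by (intro continuous_intros)+
  let ?E = "exp (- (real n * y * \<delta> / 4))"
  have "(\<Sum>m<M. (exp (real m * y) * cmod (fcoeff (\<lambda>t. wave n ?N' (of_real t) - wave n ?N (of_real t)) (- int m)))\<^sup>2)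
     \<le> mean (\<lambda>t. (cmod (wave n ?N' (?z t) - wave n ?N (?z t)))\<^sup>2)"
    by (rule bessel_entire_shift[where F = "\<lambda>z. wave n ?N' z - wave n ?N z"])
       (intro holomorphic_intros wave_holomorphic, simp only: wave_periodic)
  also have "\<dots> \<le> mean (\<lambda>t. (?E * real n)\<^sup>2 * (cmod (phase ?N' (?z t) - phase ?N (?z t)))\<^sup>2)"
  proof (rule mean_mono)
    fix t
    have "cmod (wave n ?N' (?z t) - wave n ?N (?z t)) \<le> ?E * cmod (\<i> * of_nat n * phase ?N' (?z t) - \<i> * of_nat n * phase ?N (?z t))"
      unfolding wave_def by (intro exp_diff_bound Re_wave_exponent_le N y)
    also have "\<i> * of_nat n * phase ?N' (?z t) - \<i> * of_nat n * phase ?N (?z t) = \<i> * of_nat n * (phase ?N' (?z t) - phase ?N (?z t))"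
      by (simp only: right_diff_distrib)
    finally have "cmod (wave n ?N' (?z t) - wave n ?N (?z t)) \<le> ?E * real n * cmod (phase ?N' (?z t) - phase ?N (?z t))"
      by (simp add: norm_mult)
    from power_mono[OF this, of 2]
    show "(cmod (wave n ?N' (?z t) - wave n ?N (?z t)))\<^sup>2 \<le> (?E * real n)\<^sup>2 * (cmod (phase ?N' (?z t) - phase ?N (?z t)))\<^sup>2"
      by (simp only: power_mult_distrib norm_ge_zero)
  qed (intro continuous_intros cont)+
  also have "\<dots> = (?E * real n)\<^sup>2 * mean (\<lambda>t. (cmod (phase ?N' (?z t) - phase ?N (?z t)))\<^sup>2)"
    by (rule mean_rmult)
  also have "\<dots> \<le> (?E * real n)\<^sup>2 * (4 * (exp 2 * (B / (real ?N ^ k)\<^sup>2)))"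
    by (intro mult_left_mono phase_diff_mean y) auto
  also have "\<dots> = (2 * exp 1 * sqrt B * (real n / (2 ^ l) ^ k * exp (- (rate * real n / 2 ^ l))))\<^sup>2"
  proof -
    have "?E = exp (- (rate * real n / 2 ^ l))" by (simp add: y_def rate_def mult_ac)
    moreover have "exp 2 = (exp (1::real))\<^sup>2" using exp_double[of "1::real"] by simp
    ultimately show ?thesis using B_nonneg
      by (simp add: power_mult_distrib power_divide)
  qed
  finally show ?thesis .
qed

text \<open>The coarsest level starts the telescoping and is not a difference. As \<open>l0\<close>
  is fixed, its exponential decay in \<open>n\<close> beats every power.\<close>

lemma base_bound:
  defines "y \<equiv> \<tau> / 2 ^ l0"
  shows "(\<Sum>m<M. (exp (real m * y) * cmod (fcoeff (\<lambda>t. wave n (2 ^ l0) (of_real t)) (- int m)))\<^sup>2)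
     \<le> (exp (- (rate * real n / 2 ^ l0)))\<^sup>2"
proof -
  let ?z = "\<lambda>t. of_real t + \<i> * of_real y :: complex"
  have y: "0 \<le> y" "real (2 ^ l0) * y \<le> 2 * \<tau>"
    using \<tau> by (simp_all add: y_def)
  have cont: "continuous_on A (\<lambda>t. wave n N (?z t))" for N A
    unfolding wave_def phase_def by (intro continuous_intros)
  have "(\<Sum>m<M. (exp (real m * y) * cmod (fcoeff (\<lambda>t. wave n (2 ^ l0) (of_real t)) (- int m)))\<^sup>2)
     \<le> mean (\<lambda>t. (cmod (wave n (2 ^ l0) (?z t)))\<^sup>2)"
    by (rule bessel_entire_shift[OF wave_holomorphic wave_periodic])
  also have "\<dots> \<le> mean (\<lambda>t. (exp (- (rate * real n / 2 ^ l0)))\<^sup>2)"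
  proof (rule mean_mono)
    fix t
    have "cmod (wave n (2 ^ l0) (?z t)) \<le> exp (- (real n * y * \<delta> / 4))"
      unfolding wave_def norm_exp_eq_Re exp_le_cancel_iff by (intro Re_wave_exponent_le y) simp
    also have "- (real n * y * \<delta> / 4) = - (rate * real n / 2 ^ l0)" by (simp add: y_def rate_def mult_ac)
    finally show "(cmod (wave n (2 ^ l0) (?z t)))\<^sup>2 \<le> (exp (- (rate * real n / 2 ^ l0)))\<^sup>2"
      by (intro power_mono) auto
  qed (intro continuous_intros cont)+
  finally show ?thesis by simp
qed

end

section \<open>Summation over the dyadic levels\<close>

text \<open>The weights are at least 1, which gives the first bound. The second is Cauchy-Schwarz
  against \<open>exp (- (real m * y))\<close>.\<close>

lemma weighted_l2_bounds:
  fixes a :: "nat \<Rightarrow> real"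
  assumes y: "0 < y" and Z: "0 \<le> Z" and a: "\<And>m. 0 \<le> a m"
    and w: "(\<Sum>m<M. (exp (real m * y) * a m)\<^sup>2) \<le> Z\<^sup>2"
  shows "L2_set a {..<M} \<le> Z" "(\<Sum>m<M. a m) \<le> sqrt (1 + 1 / (2 * y)) * Z"
proof -
  let ?b = "\<lambda>m. exp (real m * y) * a m"
  have b: "L2_set ?b {..<M} \<le> Z"
    unfolding L2_set_def using w Z by (simp add: real_le_lsqrt sum_nonneg)
  have "L2_set a {..<M} \<le> L2_set ?b {..<M}"
  proof (rule L2_set_mono)
    fix m
    have "1 * a m \<le> exp (real m * y) * a m"
      using y a by (intro mult_right_mono) auto
    then show "a m \<le> exp (real m * y) * a m" by simp
  qed (rule a)
  with b show "L2_set a {..<M} \<le> Z" by simp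
  have "(\<Sum>m<M. a m) = (\<Sum>m<M. \<bar>exp (- (real m * y))\<bar> * \<bar>?b m\<bar>)"
    using a by (intro sum.cong) (simp_all add: exp_minus abs_mult)
  also have "\<dots> \<le> L2_set (\<lambda>m. exp (- (real m * y))) {..<M} * L2_set ?b {..<M}"
    by (rule L2_set_mult_ineq)
  also have "\<dots> \<le> sqrt (1 + 1 / (2 * y)) * Z"
  proof (rule mult_mono[OF _ b])
    show "L2_set (\<lambda>m. exp (- (real m * y))) {..<M} \<le> sqrt (1 + 1 / (2 * y))"
      unfolding L2_set_def by (rule real_sqrt_le_mono[OF geometric_exp_bound[OF y]])
  qed (use y in \<open>auto intro: L2_set_nonneg\<close>)
  finally show "(\<Sum>m<M. a m) \<le> sqrt (1 + 1 / (2 * y)) * Z" .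
qed

text \<open>Compare the exponential series at \<open>x = c * (t + 2)\<close> with its single term of
  degree \<open>p\<close>.\<close>

lemma poly_exp_bound:
  assumes "c > (0::real)"
  shows "\<exists>C>0. \<forall>t\<ge>0. (t + 2) ^ p * exp (- (c * t)) \<le> C"
proof (intro exI conjI allI impI)
  show "0 < exp (2 * c) * fact p / c ^ p" using assms by simp
  fix t :: real assume t: "0 \<le> t"
  define x where "x = c * (t + 2)"
  have x: "0 \<le> x" using assms t by (simp add: x_def)
  have "x ^ p / fact p \<le> exp x"
  proof -
    have s: "(\<lambda>n. x ^ n / fact n) sums exp x"
      using exp_converges[of x] by (simp add: divide_inverse mult.commute)
    have "(\<Sum>n\<in>{p}. x ^ n / fact n) \<le> (\<Sum>n. x ^ n / fact n)"
      using s x by (intro sum_le_suminf) (auto simp: sums_iff)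
    then show ?thesis using s by (simp add: sums_iff)
  qed
  then have "x ^ p \<le> fact p * exp x"
    by (simp add: field_simps)
  moreover have "x ^ p = c ^ p * (t + 2) ^ p" "x = c * t + 2 * c"
    unfolding x_def by (rule power_mult_distrib) (simp add: algebra_simps)
  ultimately have "c ^ p * (t + 2) ^ p \<le> fact p * exp (c * t + 2 * c)"
    by simp
  then have "c ^ p * (t + 2) ^ p * exp (- (c * t)) \<le> fact p * exp (c * t + 2 * c) * exp (- (c * t))"
    by (rule mult_right_mono) simp
  then have "c ^ p * (t + 2) ^ p * exp (- (c * t)) \<le> fact p * exp (2 * c)"
    by (simp add: mult.assoc mult_exp_exp)
  then show "(t + 2) ^ p * exp (- (c * t)) \<le> exp (2 * c) * fact p / c ^ p"
    using assms by (simp add: field_simps)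
qed

text \<open>The last factor is the increment of \<open>N / (N + n)\<close> from \<open>N\<close> to \<open>2 N\<close>, so that these bounds
  telescope over \<open>N = 2 ^ l\<close>.\<close>

lemma dyadic_block_bound:
  fixes n N c C :: real
  assumes C: "\<forall>t\<ge>0. (t + 2) ^ (k + 1) * exp (- (c * t)) \<le> C"
    and k: "k \<ge> 2" and n: "n > 0" and N: "N > 0"
  shows "(n / N ^ k * exp (- (c * n / N))) * (1 + N / n) \<le> C / n ^ (k - 1) * (2 * N / (2 * N + n) - N / (N + n))"
proof -
  define t where "t = n / N"
  have t: "t > 0" using n N by (simp add: t_def)
  have nt: "n = t * N" using N by (simp add: t_def)
  define q where "q = k - 2"
  have q: "k = Suc (Suc q)" using k by (simp add: q_def)
  \<comment> \<open>In terms of \<open>t = n / N\<close>, the left side of the claim is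
    \<open>t ^ (q + 1) * (t + 1) * exp (- (c * t)) / n ^ (k - 1)\<close> and the increment is
    \<open>t / ((t + 1) * (t + 2))\<close>. Clearing denominators leaves a polynomial of degree
    \<open>q + 3 = k + 1\<close>, the exponent for which \<open>C\<close> was chosen.\<close>
  have "t ^ q * ((t + 1) * (t + 1) * (t + 2)) \<le> (t + 2) ^ q * ((t + 2) * (t + 2) * (t + 2))"
    using t by (intro mult_mono power_mono) auto
  also have "\<dots> = (t + 2) ^ (k + 1)" by (simp add: q power_add mult_ac)
  finally have "t ^ q * ((t + 1) * (t + 1) * (t + 2)) * exp (- (c * t)) \<le> (t + 2) ^ (k + 1) * exp (- (c * t))"
    by (rule mult_right_mono) simp
  also have "\<dots> \<le> C" using C t by simp
  finally have "t ^ q * (t + 1) * exp (- (c * t)) * ((t + 1) * (t + 2)) \<le> C"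
    by (simp add: mult_ac)
  then have "t ^ q * (t + 1) * exp (- (c * t)) \<le> C / ((t + 1) * (t + 2))"
    using t by (simp add: pos_le_divide_eq)
  then have "t * (t ^ q * (t + 1) * exp (- (c * t))) \<le> t * (C / ((t + 1) * (t + 2)))"
    using t by (intro mult_left_mono) auto
  then have main: "t ^ Suc q * (t + 1) * exp (- (c * t)) / n ^ (k - 1) \<le> C * (t / ((t + 1) * (t + 2))) / n ^ (k - 1)"
    using n by (intro divide_right_mono) (auto simp: mult_ac)
  have "(n / N ^ k * exp (- (c * n / N))) * (1 + N / n) = t ^ Suc q * (t + 1) * exp (- (c * t)) / n ^ (k - 1)"
    using t N unfolding nt q by (simp add: field_simps power_mult_distrib)
  moreover have "2 * N / (2 * N + n) - N / (N + n) = t / ((t + 1) * (t + 2))"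
  proof -
    have "2 * N / (2 * N + n) = 2 / (t + 2)" "N / (N + n) = 1 / (t + 1)"
    proof -
      have "2 * N + n = N * (t + 2)" "N + n = N * (t + 1)"
        by (simp_all add: nt algebra_simps)
      then show "2 * N / (2 * N + n) = 2 / (t + 2)" "N / (N + n) = 1 / (t + 1)"
        using N by simp_all
    qed
    moreover have "2 / (t + 2) - 1 / (t + 1) = t / ((t + 1) * (t + 2))"
      using t by (simp add: field_simps)
    ultimately show ?thesis by simp
  qed
  ultimately show ?thesis using main by (simp add: mult.commute)
qed

context circle_phase
begin

text \<open>Telescope from level \<open>l0\<close> to \<open>L\<close>. Each block enters the square
  norm with size \<open>Z l\<close> and the absolute sum with an extra factor of order
  \<open>sqrt n * x l\<close>; since \<open>x l \<ge> 1\<close>, the single sum \<open>T\<close>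
  controls both. The constant depends on neither \<open>L\<close> nor \<open>M\<close>, which allows
  a later passage to the limit.\<close>

lemma wave_coeff_bounds:
  "\<exists>C>0. \<forall>n\<ge>1. \<forall>L\<ge>l0. \<forall>M.
     L2_set (\<lambda>m. cmod (fcoeff (\<lambda>t. wave n (2 ^ L) (of_real t)) (- int m))) {..<M} \<le> C / real n ^ (k - 1) \<and>
     (\<Sum>m<M. cmod (fcoeff (\<lambda>t. wave n (2 ^ L) (of_real t)) (- int m))) \<le> sqrt (real n) * (C / real n ^ (k - 1))"
proof -
  obtain C where Cpos: "C > 0" and C: "\<forall>t\<ge>0. (t + 2) ^ (k + 1) * exp (- (rate * t)) \<le> C"
    using poly_exp_bound[OF rate_pos] by blast
  define X where "X = 2 * exp 1 * sqrt B"
  \<comment> \<open>The base term: the first factor bounds \<open>x l0\<close> for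
    \<open>n \<ge> 1\<close>, the other two bound \<open>real n ^ (k - 1) * Z0\<close>.\<close>
  define C0 where "C0 = (1 + 2 ^ l0) * (2 ^ l0) ^ (k - 1) * C"
  define K where "K = (C0 + X * C) / sqrt \<tau>"
  have X: "X \<ge> 0" using B_nonneg by (simp add: X_def)
  have C0: "C0 > 0" using Cpos by (simp add: C0_def add_pos_pos)
  have Kpos: "K > 0" using C0 X Cpos \<tau> by (simp add: K_def add_pos_nonneg)
  show ?thesis
  proof (intro exI[of _ K] conjI allI impI Kpos)
    fix n L M :: nat assume n: "1 \<le> n" and L: "l0 \<le> L"
    define w where "w = (\<lambda>l m. fcoeff (\<lambda>t. wave n (2 ^ l) (of_real t)) (- int m))"
    define Z where "Z = (\<lambda>l. X * (real n / (2 ^ l) ^ k * exp (- (rate * real n / 2 ^ l))))"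
    define Z0 where "Z0 = exp (- (rate * real n / 2 ^ l0))"
    define x where "x = (\<lambda>l. 1 + 2 ^ l / real n)"
    define T where "T = Z0 * x l0 + (\<Sum>l\<in>{l0..<L}. Z l * x l)"
    have Znn: "Z l \<ge> 0" and Z0nn: "Z0 \<ge> 0" and x1: "x l \<ge> 1" for l
      using X by (simp_all add: Z_def Z0_def x_def)
    have ypos: "0 < \<tau> / 2 ^ l" for l :: nat using \<tau> by simp
    \<comment> \<open>The square of the right side is
      \<open>n / \<tau> + 2 * N / \<tau> + N\<^sup>2 / (n * \<tau>)\<close> with
      \<open>N = 2 ^ l\<close>. Its first term exceeds 1 and its second exceeds
      \<open>N / (2 * \<tau>)\<close>.\<close>
    have sq: "sqrt (1 + 1 / (2 * (\<tau> / 2 ^ l))) \<le> sqrt (real n / \<tau>) * x l" for l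
    proof -
      define N :: real where "N = 2 ^ l"
      have N: "N > 0" by (simp add: N_def)
      have "1 \<le> real n / \<tau>" using n \<tau> by (simp add: field_simps)
      moreover have "N / (2 * \<tau>) \<le> 2 * N / \<tau>" using N \<tau> by (simp add: field_simps)
      moreover have "0 \<le> N\<^sup>2 / (real n * \<tau>)" using \<tau> by simp
      moreover have "real n / \<tau> * (1 + N / real n)\<^sup>2 = real n / \<tau> + 2 * N / \<tau> + N\<^sup>2 / (real n * \<tau>)"
        using n \<tau> by (simp add: field_simps power2_eq_square)
      ultimately have "1 + 1 / (2 * (\<tau> / N)) \<le> real n / \<tau> * (1 + N / real n)\<^sup>2"
        by simp
      then have "sqrt (1 + 1 / (2 * (\<tau> / N))) \<le> sqrt (real n / \<tau> * (1 + N / real n)\<^sup>2)"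
        by (rule real_sqrt_le_mono)
      also have "\<dots> = sqrt (real n / \<tau>) * (1 + N / real n)"
        using N n by (simp only: real_sqrt_mult real_sqrt_abs) simp
      finally show ?thesis by (simp add: x_def N_def)
    qed
    have cont: "continuous_on A (\<lambda>t. wave n N (of_real t))" for N A
      unfolding wave_def phase_def by (intro continuous_intros)
    have d: "fcoeff (\<lambda>t. wave n (2 ^ Suc l) (of_real t) - wave n (2 ^ l) (of_real t)) (- int m) = w (Suc l) m - w l m" for l m
      unfolding fcoeff_def w_def left_diff_distrib
      by (subst mean_diff, (intro continuous_intros cont)+, rule refl)
    have dl: "L2_set (\<lambda>m. cmod (w (Suc l) m - w l m)) {..<M} \<le> Z l"
         "(\<Sum>m<M. cmod (w (Suc l) m - w l m)) \<le> sqrt (1 + 1 / (2 * (\<tau> / 2 ^ l))) * Z l" if "l0 \<le> l" for l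
    proof -
      have "(\<Sum>m<M. (exp (real m * (\<tau> / 2 ^ l)) * cmod (w (Suc l) m - w l m))\<^sup>2) \<le> (Z l)\<^sup>2"
        using block_bound[OF that, of n M] unfolding d X_def Z_def .
      from weighted_l2_bounds[OF ypos Znn _ this]
      show "L2_set (\<lambda>m. cmod (w (Suc l) m - w l m)) {..<M} \<le> Z l"
         "(\<Sum>m<M. cmod (w (Suc l) m - w l m)) \<le> sqrt (1 + 1 / (2 * (\<tau> / 2 ^ l))) * Z l"
        by simp_all
    qed
    have d0: "L2_set (\<lambda>m. cmod (w l0 m)) {..<M} \<le> Z0"
         "(\<Sum>m<M. cmod (w l0 m)) \<le> sqrt (1 + 1 / (2 * (\<tau> / 2 ^ l0))) * Z0"
    proof -
      have "(\<Sum>m<M. (exp (real m * (\<tau> / 2 ^ l0)) * cmod (w l0 m))\<^sup>2) \<le> Z0\<^sup>2"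
        using base_bound[of n M] unfolding w_def Z0_def .
      from weighted_l2_bounds[OF ypos Z0nn _ this]
      show "L2_set (\<lambda>m. cmod (w l0 m)) {..<M} \<le> Z0"
         "(\<Sum>m<M. cmod (w l0 m)) \<le> sqrt (1 + 1 / (2 * (\<tau> / 2 ^ l0))) * Z0"
        by simp_all
    qed
    have tele: "w L m = w l0 m + (\<Sum>l\<in>{l0..<L}. w (Suc l) m - w l m)" for m
      using sum_Suc_diff'[OF L, of "\<lambda>l. w l m"] by simp
    have L2: "L2_set (\<lambda>m. cmod (w L m)) {..<M} \<le> T"
    proof -
      have "L2_set (\<lambda>m. cmod (w L m)) {..<M} \<le> L2_set (\<lambda>m. cmod (w l0 m) + cmod (\<Sum>l\<in>{l0..<L}. w (Suc l) m - w l m)) {..<M}"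
        by (intro L2_set_mono) (auto simp: tele intro: norm_triangle_ineq)
      also have "\<dots> \<le> L2_set (\<lambda>m. cmod (w l0 m)) {..<M} + L2_set (\<lambda>m. cmod (\<Sum>l\<in>{l0..<L}. w (Suc l) m - w l m)) {..<M}"
        by (rule L2_set_triangle_ineq)
      also have "\<dots> \<le> Z0 + (\<Sum>l\<in>{l0..<L}. Z l)"
        by (intro add_mono d0 order_trans[OF L2_set_sum_triangle] sum_mono dl) auto
      also have "\<dots> \<le> T"
      proof -
        have "u \<le> u * x l" if "0 \<le> u" for u l
          using mult_left_mono[OF x1 that, of l] by simp
        then show ?thesis unfolding T_def using Znn Z0nn by (intro add_mono sum_mono) auto
      qed
      finally show ?thesis .
    qed
    have L1: "(\<Sum>m<M. cmod (w L m)) \<le> sqrt (real n / \<tau>) * T"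
    proof -
      have "(\<Sum>m<M. cmod (w L m)) \<le> (\<Sum>m<M. cmod (w l0 m) + (\<Sum>l\<in>{l0..<L}. cmod (w (Suc l) m - w l m)))"
        by (intro sum_mono) (auto simp: tele intro!: order_trans[OF norm_triangle_ineq] norm_sum)
      also have "\<dots> = (\<Sum>m<M. cmod (w l0 m)) + (\<Sum>l\<in>{l0..<L}. \<Sum>m<M. cmod (w (Suc l) m - w l m))"
        by (simp add: sum.distrib sum.swap[of _ _ "{..<M}"])
      also have "\<dots> \<le> sqrt (real n / \<tau>) * x l0 * Z0 + (\<Sum>l\<in>{l0..<L}. sqrt (real n / \<tau>) * x l * Z l)"
        by (intro add_mono sum_mono order_trans[OF d0(2)] order_trans[OF dl(2)] mult_right_mono sq Znn Z0nn) auto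
      also have "\<dots> = sqrt (real n / \<tau>) * T"
        by (simp add: T_def sum_distrib_left algebra_simps)
      finally show ?thesis .
    qed
    have T: "T \<le> (C0 + X * C) / real n ^ (k - 1)"
    proof -
      \<comment> \<open>The total increment of \<open>\<Phi>\<close> is at most 1, so the number of
        levels does not enter the bound.\<close>
      define \<Phi> where "\<Phi> = (\<lambda>l. 2 ^ l / (2 ^ l + real n))"
      have "Z l * x l \<le> X * (C / real n ^ (k - 1)) * (\<Phi> (Suc l) - \<Phi> l)" for l
        using mult_left_mono[OF dyadic_block_bound[OF C k, of "real n" "2 ^ l"] X] n
        by (simp add: Z_def x_def \<Phi>_def mult.assoc)
      then have "(\<Sum>l\<in>{l0..<L}. Z l * x l) \<le> (\<Sum>l\<in>{l0..<L}. X * (C / real n ^ (k - 1)) * (\<Phi> (Suc l) - \<Phi> l))"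
        by (intro sum_mono)
      also have "\<dots> = X * (C / real n ^ (k - 1)) * (\<Phi> L - \<Phi> l0)"
        unfolding sum_distrib_left[symmetric] sum_Suc_diff'[OF L] ..
      also have "\<dots> \<le> X * (C / real n ^ (k - 1)) * 1"
      proof (rule mult_left_mono)
        have "\<Phi> L \<le> 1" "0 \<le> \<Phi> l0" unfolding \<Phi>_def by (simp_all add: divide_le_eq_1 add_pos_nonneg)
        then show "\<Phi> L - \<Phi> l0 \<le> 1" by simp
      qed (use X Cpos in auto)
      finally have s: "(\<Sum>l\<in>{l0..<L}. Z l * x l) \<le> X * C / real n ^ (k - 1)" by simp
      have "Z0 * x l0 \<le> C0 / real n ^ (k - 1)"
      proof -
        define t where "t = real n / 2 ^ l0"
        have t: "t \<ge> 0" by (simp add: t_def)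
        have "t ^ (k - 1) \<le> (t + 2) ^ (k - 1)" using t by (intro power_mono) auto
        also have "\<dots> \<le> (t + 2) ^ (k + 1)" using t by (intro power_increasing) auto
        finally have "t ^ (k - 1) * exp (- (rate * t)) \<le> (t + 2) ^ (k + 1) * exp (- (rate * t))"
          by (rule mult_right_mono) simp
        also have "\<dots> \<le> C" using C t by blast
        finally have "(2 ^ l0) ^ (k - 1) * (t ^ (k - 1) * exp (- (rate * t))) \<le> (2 ^ l0) ^ (k - 1) * C"
          by (rule mult_left_mono) simp
        moreover have "(2 ^ l0) ^ (k - 1) * t ^ (k - 1) = real n ^ (k - 1)"
          unfolding power_mult_distrib[symmetric] by (simp add: t_def)
        moreover have "Z0 = exp (- (rate * t))" by (simp add: Z0_def t_def)
        ultimately have "real n ^ (k - 1) * Z0 \<le> (2 ^ l0) ^ (k - 1) * C"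
          by (simp only: mult.assoc[symmetric])
        moreover have "x l0 \<le> 1 + 2 ^ l0"
          using n by (simp add: x_def field_simps)
        ultimately have "(real n ^ (k - 1) * Z0) * x l0 \<le> ((2 ^ l0) ^ (k - 1) * C) * (1 + 2 ^ l0)"
          by (rule mult_mono) (use x1[of l0] Z0nn Cpos in auto)
        then show ?thesis using n by (simp add: C0_def pos_le_divide_eq mult_ac)
      qed
      with s show ?thesis unfolding T_def by (simp add: add_divide_distrib)
    qed
    \<comment> \<open>Because \<open>sqrt \<tau> \<le> 1\<close>, the constant \<open>K\<close> with
      its division by \<open>sqrt \<tau>\<close> serves for the square norm as well as for the
      absolute sum.\<close>
    have st: "0 < sqrt \<tau>" "sqrt \<tau> \<le> 1" using \<tau> by (auto simp: real_le_lsqrt)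
    have TK: "T / sqrt \<tau> \<le> K / real n ^ (k - 1)"
      using divide_right_mono[OF T, of "sqrt \<tau>"] st by (simp add: K_def mult.commute)
    have Tnn: "0 \<le> T" using L2 by (meson L2_set_nonneg order_trans)
    have "T \<le> T / sqrt \<tau>" using st Tnn by (simp add: pos_le_divide_eq mult_left_le)
    then show "L2_set (\<lambda>m. cmod (fcoeff (\<lambda>t. wave n (2 ^ L) (of_real t)) (- int m))) {..<M} \<le> K / real n ^ (k - 1)"
      using L2 TK unfolding w_def by linarith
    have "(\<Sum>m<M. cmod (w L m)) \<le> sqrt (real n) * (T / sqrt \<tau>)"
      using L1 by (simp add: real_sqrt_divide)
    also have "\<dots> \<le> sqrt (real n) * (K / real n ^ (k - 1))"
      using TK by (intro mult_left_mono) auto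
    finally show "(\<Sum>m<M. cmod (fcoeff (\<lambda>t. wave n (2 ^ L) (of_real t)) (- int m))) \<le> sqrt (real n) * (K / real n ^ (k - 1))"
      unfolding w_def .
  qed
qed

end

section \<open>Passage to the full phase and estimate of the defect\<close>

text \<open>Some partial sum lies uniformly within \<epsilon> of \<open>R\<close> and has mean
  square at most the square of \<epsilon> by Parseval. The inequality for the square of a sum then
  costs the factor 4.\<close>

lemma mean_square_absolutely_convergent:
  fixes c :: "nat \<Rightarrow> complex"
  assumes summ: "summable (\<lambda>m. cmod (c m))" and \<epsilon>: "\<epsilon> > 0"
    and l2: "\<And>M. L2_set (\<lambda>m. cmod (c m)) {..<M} \<le> \<epsilon>"
  defines "R \<equiv> \<lambda>t. \<Sum>m. c m * cis (- (real m * t))"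
  shows "continuous_on UNIV R" "mean (\<lambda>t. (cmod (R t))\<^sup>2) \<le> 4 * \<epsilon>\<^sup>2"
proof -
  have unif: "uniform_limit UNIV (\<lambda>M t. \<Sum>m<M. c m * cis (- (real m * t))) R sequentially"
    unfolding R_def by (rule Weierstrass_m_test[OF _ summ]) (simp add: norm_mult)
  show contR: "continuous_on UNIV R"
    by (rule uniform_limit_theorem[OF _ unif]) (auto intro!: always_eventually continuous_intros)
  from unif \<epsilon> obtain M where M: "\<And>t. dist (\<Sum>m<M. c m * cis (- (real m * t))) (R t) < \<epsilon>"
    unfolding uniform_limit_iff eventually_sequentially by blast
  define P where "P = (\<lambda>t. \<Sum>m<M. c m * cis (of_int (- int m) * t))"
  have contP: "cont_circle P" unfolding P_def by (intro continuous_intros)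
  have "mean (\<lambda>t. (cmod (P t))\<^sup>2) = (\<Sum>m<M. (cmod (c m))\<^sup>2)"
    unfolding P_def by (rule trig_poly_norm) (auto simp: inj_on_def)
  also have "\<dots> = (L2_set (\<lambda>m. cmod (c m)) {..<M})\<^sup>2"
    by (simp add: L2_set_def sum_nonneg)
  also have "\<dots> \<le> \<epsilon>\<^sup>2" by (intro power_mono l2 L2_set_nonneg)
  finally have P: "mean (\<lambda>t. (cmod (P t))\<^sup>2) \<le> \<epsilon>\<^sup>2" .
  have "mean (\<lambda>t. (cmod (R t))\<^sup>2) \<le> mean (\<lambda>t. 2 * (cmod (P t))\<^sup>2 + 2 * \<epsilon>\<^sup>2)"
  proof (rule mean_mono)
    fix t
    have "cmod (R t) \<le> cmod (P t) + cmod (R t - P t)"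
      using norm_triangle_ineq[of "P t" "R t - P t"] by simp
    also have "\<dots> \<le> cmod (P t) + \<epsilon>"
      using M[of t] by (simp add: P_def dist_norm norm_minus_commute)
    finally have "(cmod (R t))\<^sup>2 \<le> (cmod (P t) + \<epsilon>)\<^sup>2" by (intro power_mono) auto
    also have "\<dots> \<le> 2 * (cmod (P t))\<^sup>2 + 2 * \<epsilon>\<^sup>2"
      using sum_squares_bound[of "cmod (P t)" \<epsilon>] by (simp add: power2_sum)
    finally show "(cmod (R t))\<^sup>2 \<le> 2 * (cmod (P t))\<^sup>2 + 2 * \<epsilon>\<^sup>2" .
  qed (intro continuous_intros contP continuous_on_subset[OF contR] subset_UNIV)+
  also have "\<dots> = 2 * mean (\<lambda>t. (cmod (P t))\<^sup>2) + 2 * \<epsilon>\<^sup>2"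
    by (subst mean_add, (intro continuous_intros contP)+, simp only: mean_rmult mean_const)
  also have "\<dots> \<le> 4 * \<epsilon>\<^sup>2" using P by simp
  finally show "mean (\<lambda>t. (cmod (R t))\<^sup>2) \<le> 4 * \<epsilon>\<^sup>2" .
qed

context circle_phase
begin

definition full_wave :: "nat \<Rightarrow> real \<Rightarrow> complex" where
  "full_wave n t = cis (real n * (t - 2 * Im (G (cis t))))"

lemma full_wave_eq:
  "full_wave n t = cis (real n * t) * exp (of_nat n * cnj (G (cis t)) - of_nat n * G (cis t))"
proof -
  have "of_nat n * cnj (G (cis t)) - of_nat n * G (cis t) = \<i> * of_real (- 2 * real n * Im (G (cis t)))"
    by (simp add: complex_eq_iff)
  then have "exp (of_nat n * cnj (G (cis t)) - of_nat n * G (cis t)) = cis (- 2 * real n * Im (G (cis t)))"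
    by (simp only: cis_conv_exp)
  then show ?thesis by (simp add: full_wave_def cis_mult algebra_simps)
qed

lemma C1_full_wave: "C1 (full_wave n)"
  using C1_mult[OF C1_cis[of "real n"] C1_exp[OF C1_diff[OF C1_mult[OF C1_const C1_cnj[OF C1_G]] C1_mult[OF C1_const C1_G]]]]
  unfolding full_wave_eq[abs_def] .

lemma periodic_full_wave: "periodic_2pi (full_wave n)"
  unfolding periodic_2pi_def full_wave_eq
  by (simp add: Complex.DeMoivre[symmetric] cis_mult[symmetric])

lemma wave_real: "wave n N (of_real t) = cis (real n * (t - 2 * Im (\<Sum>j\<le>N. \<alpha> j * cis t ^ j)))"
proof -
  have "\<alpha> j * exp (\<i> * of_nat j * of_real t) - cnj (\<alpha> j) * exp (- (\<i> * of_nat j * of_real t))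
     = of_real (2 * Im (\<alpha> j * cis t ^ j)) * \<i>" for j
    using exp_strip[of j t 0] complex_diff_cnj[of "\<alpha> j * cis (real j * t)"]
    by (simp add: Complex.DeMoivre cis_cnj)
  then have "phase N (of_real t) = of_real (t - 2 * Im (\<Sum>j\<le>N. \<alpha> j * cis t ^ j))"
  proof -
    assume *: "\<And>j. \<alpha> j * exp (\<i> * of_nat j * of_real t) - cnj (\<alpha> j) * exp (- (\<i> * of_nat j * of_real t))
     = of_real (2 * Im (\<alpha> j * cis t ^ j)) * \<i>"
    have "phase N (of_real t) = of_real t + \<i> * (of_real (\<Sum>j\<le>N. 2 * Im (\<alpha> j * cis t ^ j)) * \<i>)"
      unfolding phase_def * of_real_sum sum_distrib_right ..
    also have "\<dots> = of_real (t - (\<Sum>j\<le>N. 2 * Im (\<alpha> j * cis t ^ j)))"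
    proof -
      have "of_real t + \<i> * (of_real x * \<i>) = complex_of_real (t - x)" for x
        by (simp add: complex_eq_iff)
      then show ?thesis .
    qed
    also have "(\<Sum>j\<le>N. 2 * Im (\<alpha> j * cis t ^ j)) = 2 * Im (\<Sum>j\<le>N. \<alpha> j * cis t ^ j)"
      unfolding Im_sum sum_distrib_left ..
    finally show ?thesis .
  qed
  then show ?thesis
    unfolding wave_def cis_conv_exp[of "real n * x" for x]
    by (simp only: of_real_mult of_real_of_nat_eq mult.assoc)
qed

text \<open>The exponential has Lipschitz constant 1 on the imaginary axis, and the partial sums of
  \<open>G\<close> converge uniformly on the closed disc.\<close>

lemma wave_uniform_limit:
  "uniform_limit UNIV (\<lambda>L t. wave n (2 ^ L) (of_real t)) (full_wave n) sequentially"
  unfolding uniform_limit_iff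
proof (intro allI impI)
  fix e :: real assume e: "e > 0"
  define e' where "e' = e / (2 * real n + 1)"
  have e': "e' > 0" using e by (simp add: e'_def add_nonneg_pos)
  have "uniform_limit (cball 0 1) (\<lambda>N z. \<Sum>j<N. \<alpha> j * z ^ j) G sequentially"
    unfolding G_def
    by (rule Weierstrass_m_test[OF _ summable_\<alpha>]) (simp add: norm_mult norm_power mult_left_le power_le_one)
  then have "\<forall>\<^sub>F N in sequentially. \<forall>z\<in>cball 0 1. dist (\<Sum>j<N. \<alpha> j * z ^ j) (G z) < e'"
    using e' by (simp add: uniform_limit_iff)
  \<comment> \<open>Truncation at level \<open>2 ^ L\<close> includes the index
    \<open>2 ^ L\<close>, so the matching partial sum has \<open>Suc (2 ^ L)\<close> terms.\<close>
  moreover have "filterlim (\<lambda>L. Suc (2 ^ L)) sequentially sequentially"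
    by (rule filterlim_subseq) (auto simp: strict_mono_def)
  ultimately have "\<forall>\<^sub>F L in sequentially. \<forall>z\<in>cball 0 1. dist (\<Sum>j<Suc (2 ^ L). \<alpha> j * z ^ j) (G z) < e'"
    by (rule eventually_compose_filterlim)
  then show "\<forall>\<^sub>F L in sequentially. \<forall>t\<in>UNIV. dist (wave n (2 ^ L) (of_real t)) (full_wave n t) < e"
  proof eventually_elim
    case (elim L)
    show ?case
    proof
      fix t
      let ?A = "\<Sum>j\<le>2 ^ L. \<alpha> j * cis t ^ j"
      have "cmod (?A - G (cis t)) < e'"
        using elim[rule_format, of "cis t"] by (simp add: dist_norm lessThan_Suc_atMost)
      then have A: "\<bar>Im ?A - Im (G (cis t))\<bar> < e'"
        using abs_Im_le_cmod[of "?A - G (cis t)"] by simp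
      have "dist (wave n (2 ^ L) (of_real t)) (full_wave n t)
          \<le> exp 0 * cmod (\<i> * of_real (real n * (t - 2 * Im ?A)) - \<i> * of_real (real n * (t - 2 * Im (G (cis t)))))"
        unfolding wave_real full_wave_def dist_norm cis_conv_exp by (rule exp_diff_bound) simp_all
      also have "\<i> * of_real (real n * (t - 2 * Im ?A)) - \<i> * of_real (real n * (t - 2 * Im (G (cis t))))
         = \<i> * of_real (2 * real n * (Im (G (cis t)) - Im ?A))"
        by (simp add: algebra_simps)
      also have "exp 0 * cmod \<dots> = 2 * real n * \<bar>Im ?A - Im (G (cis t))\<bar>"
        unfolding norm_mult norm_of_real by (simp add: abs_mult abs_minus_commute)
      also have "\<dots> \<le> 2 * real n * e'" using A by (intro mult_left_mono) auto
      also have "\<dots> < e" using e by (simp add: e'_def field_simps add_nonneg_pos)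
      finally show "dist (wave n (2 ^ L) (of_real t)) (full_wave n t) < e" .
    qed
  qed
qed

text \<open>For fixed \<open>M\<close> only finitely many coefficients occur, each the limit of the
  coefficients of the truncated waves; the bounds uniform in \<open>L\<close> survive the
  limit.\<close>

lemma full_wave_coeff_bounds:
  "\<exists>C>0. \<forall>n\<ge>1. \<forall>M.
     L2_set (\<lambda>m. cmod (fcoeff (full_wave n) (- int m))) {..<M} \<le> C / real n ^ (k - 1) \<and>
     (\<Sum>m<M. cmod (fcoeff (full_wave n) (- int m))) \<le> sqrt (real n) * (C / real n ^ (k - 1))"
proof -
  obtain C where C: "C > 0" "\<And>n L M. n \<ge> 1 \<Longrightarrow> L \<ge> l0 \<Longrightarrow>
     L2_set (\<lambda>m. cmod (fcoeff (\<lambda>t. wave n (2 ^ L) (of_real t)) (- int m))) {..<M} \<le> C / real n ^ (k - 1) \<and>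
     (\<Sum>m<M. cmod (fcoeff (\<lambda>t. wave n (2 ^ L) (of_real t)) (- int m))) \<le> sqrt (real n) * (C / real n ^ (k - 1))"
    using wave_coeff_bounds by blast
  have lim: "(\<lambda>L. fcoeff (\<lambda>t. wave n (2 ^ L) (of_real t)) j) \<longlonglongrightarrow> fcoeff (full_wave n) j" for n j
    unfolding fcoeff_def
  proof (rule mean_tendsto)
    show "uniform_limit UNIV (\<lambda>L t. wave n (2 ^ L) (of_real t) * cis (- (of_int j * t))) (\<lambda>t. full_wave n t * cis (- (of_int j * t))) sequentially"
      using wave_uniform_limit[of n] unfolding uniform_limit_iff dist_norm
      by (simp add: norm_mult flip: left_diff_distrib)
    show "cont_circle (\<lambda>t. wave n (2 ^ L) (of_real t) * cis (- (of_int j * t)))" for L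
      unfolding wave_def phase_def by (intro continuous_intros)
  qed
  show ?thesis
  proof (intro exI[of _ C] conjI allI impI C(1))
    fix n M :: nat assume n: "1 \<le> n"
    show "L2_set (\<lambda>m. cmod (fcoeff (full_wave n) (- int m))) {..<M} \<le> C / real n ^ (k - 1)"
    proof (rule LIMSEQ_le_const2)
      show "(\<lambda>L. L2_set (\<lambda>m. cmod (fcoeff (\<lambda>t. wave n (2 ^ L) (of_real t)) (- int m))) {..<M})
          \<longlonglongrightarrow> L2_set (\<lambda>m. cmod (fcoeff (full_wave n) (- int m))) {..<M}"
        unfolding L2_set_def by (intro tendsto_intros lim)
    qed (use C(2)[OF n] in blast)
    show "(\<Sum>m<M. cmod (fcoeff (full_wave n) (- int m))) \<le> sqrt (real n) * (C / real n ^ (k - 1))"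
    proof (rule LIMSEQ_le_const2)
      show "(\<lambda>L. \<Sum>m<M. cmod (fcoeff (\<lambda>t. wave n (2 ^ L) (of_real t)) (- int m)))
          \<longlonglongrightarrow> (\<Sum>m<M. cmod (fcoeff (full_wave n) (- int m)))"
        by (intro tendsto_intros lim)
    qed (use C(2)[OF n] in blast)
  qed
qed

text \<open>The absolute sum of the coefficients makes \<open>R\<close> uniformly at most
  \<open>1 / 2\<close>, as \<open>leading_coeff_defect\<close> demands. The square norm then yields
  the rate.\<close>

lemma leading_coeff_asymptotics:
  "\<exists>K>0. \<exists>n0. \<forall>n\<ge>n0. \<forall>V v0 p. (\<forall>t. V t = v0 + 2 * Re (G (cis t))) \<longrightarrow>
     orthonormal_polys (\<lambda>t. exp (- real n * V t)) p \<longrightarrow>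
     \<bar>(Re (lead_coeff (p (n - 1))))\<^sup>2 * exp (- real n * v0) - 1\<bar> \<le> K / real n ^ (2 * (k - 1))"
proof -
  obtain C where C: "C > 0" and bd: "\<And>n M. n \<ge> 1 \<Longrightarrow>
     L2_set (\<lambda>m. cmod (fcoeff (full_wave n) (- int m))) {..<M} \<le> C / real n ^ (k - 1) \<and>
     (\<Sum>m<M. cmod (fcoeff (full_wave n) (- int m))) \<le> sqrt (real n) * (C / real n ^ (k - 1))"
    using full_wave_coeff_bounds by blast
  \<comment> \<open>Chosen so that the uniform bound \<open>C / sqrt (real n)\<close> for
    \<open>R\<close> is at most \<open>1 / 2\<close>.\<close>
  define n0 where "n0 = max 1 (nat \<lceil>(2 * C)\<^sup>2\<rceil>)"
  have "\<bar>(Re (lead_coeff (p (n - 1))))\<^sup>2 * exp (- real n * v0) - 1\<bar> \<le> (8 * C\<^sup>2) / real n ^ (2 * (k - 1))"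
    if n0: "n0 \<le> n" and V: "\<forall>t. V t = v0 + 2 * Re (G (cis t))"
      and orth: "orthonormal_polys (\<lambda>t. exp (- real n * V t)) p" for n V v0 p
  proof -
    have n: "1 \<le> n" "(2 * C)\<^sup>2 \<le> real n"
      using n0 unfolding n0_def by (simp, linarith)
    define \<epsilon> where "\<epsilon> = C / real n ^ (k - 1)"
    have \<epsilon>: "\<epsilon> > 0" using C n by (simp add: \<epsilon>_def)
    define c where "c = (\<lambda>m. fcoeff (full_wave n) (- int m))"
    define R where "R = (\<lambda>t. \<Sum>m. c m * cis (- (real m * t)))"
    \<comment> \<open>Frequency 0 is assigned to \<open>R\<close>, so \<open>H\<close> starts at
      frequency 1 and vanishes at the origin.\<close>
    define H where "H = (\<lambda>z. z ^ 1 * (\<Sum>j. fcoeff (full_wave n) (int (Suc j)) * z ^ j))"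
    note w = C1_wiener[OF C1_full_wave periodic_full_wave, of n]
    have sc: "summable (\<lambda>m. cmod (c m))" using w(2) by (simp add: c_def)
    have sH: "summable (\<lambda>j. cmod (fcoeff (full_wave n) (int (Suc j))))"
      using w(1) summable_Suc_iff[of "\<lambda>j. cmod (fcoeff (full_wave n) (int j))"] by simp
    have l2: "L2_set (\<lambda>m. cmod (c m)) {..<M} \<le> \<epsilon>" for M
      using bd[OF n(1)] by (simp add: c_def \<epsilon>_def)
    have R: "continuous_on UNIV R" "mean (\<lambda>t. (cmod (R t))\<^sup>2) \<le> 4 * \<epsilon>\<^sup>2"
      unfolding R_def by (rule mean_square_absolutely_convergent[OF sc \<epsilon> l2])+
    have sR: "summable (\<lambda>m. c m * cis (- (real m * t)))" for t
      by (rule summable_norm_cancel) (simp add: norm_mult sc)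
    have "cmod (R t) \<le> 1 / 2" for t
    proof -
      have "cmod (R t) \<le> (\<Sum>m. cmod (c m * cis (- (real m * t))))"
        unfolding R_def by (rule summable_norm) (simp add: norm_mult sc)
      also have "\<dots> = (\<Sum>m. cmod (c m))" by (simp add: norm_mult)
      also have "\<dots> \<le> sqrt (real n) * \<epsilon>"
        by (rule suminf_le_const[OF sc]) (use bd[OF n(1)] in \<open>simp add: c_def \<epsilon>_def\<close>)
      also have "\<dots> \<le> sqrt (real n) * (C / real n)"
      proof -
        have "real n ^ 1 \<le> real n ^ (k - 1)" using n k by (intro power_increasing) auto
        then show ?thesis unfolding \<epsilon>_def using n C by (intro mult_left_mono divide_left_mono) auto
      qed
      also have "\<dots> = C / sqrt (real n)"
        using n by (simp add: field_simps flip: power2_eq_square)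
      also have "\<dots> \<le> 1 / 2"
      proof -
        have "2 * C \<le> sqrt (real n)" using n(2) by (rule real_le_rsqrt)
        then show ?thesis using n by (simp add: field_simps)
      qed
      finally show ?thesis .
    qed
    moreover have "full_wave n t = H (cis t) + R t" for t
    proof -
      let ?f = "\<lambda>j. fcoeff (full_wave n) (int j) * cis (real j * t)"
      have "summable ?f" by (rule summable_norm_cancel) (simp add: norm_mult w(1))
      then have "(\<Sum>j. ?f j) = (\<Sum>j. ?f (Suc j)) + ?f 0"
        using suminf_split_head[of ?f] by simp
      moreover have "(\<Sum>j. ?f (Suc j)) = H (cis t)"
      proof -
        have "summable (\<lambda>j. fcoeff (full_wave n) (int (Suc j)) * cis t ^ j)"
          by (rule summable_norm_cancel) (use sH in \<open>simp add: norm_mult norm_power\<close>)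
        from suminf_mult[OF this, of "cis t"]
        have "H (cis t) = (\<Sum>j. cis t * (fcoeff (full_wave n) (int (Suc j)) * cis t ^ j))"
          by (simp add: H_def)
        also have "\<dots> = (\<Sum>j. ?f (Suc j))"
        proof (rule suminf_cong)
          fix j
          have "cis (real (Suc j) * t) = cis t * cis t ^ j"
            using Complex.DeMoivre[of t "Suc j"] by simp
          then show "cis t * (fcoeff (full_wave n) (int (Suc j)) * cis t ^ j) = ?f (Suc j)"
            by (simp only: mult_ac)
        qed
        finally show ?thesis by simp
      qed
      moreover have "R t = (\<Sum>j. fcoeff (full_wave n) (- int (Suc j)) * cis (- (real (Suc j) * t))) + ?f 0"
        using suminf_split_head[OF sR[of t]] by (simp add: R_def c_def)
      ultimately show ?thesis using w(3)[of t] by simp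
    qed
    moreover have "disc_alg H"
      unfolding H_def by (intro disc_alg_mult disc_alg_power disc_alg_series sH)
    moreover have "H 0 = 0" by (simp add: H_def)
    ultimately have "\<bar>(Re (lead_coeff (p (n - 1))))\<^sup>2 * exp (- real n * v0) - 1\<bar> \<le> 2 * mean (\<lambda>t. (cmod (R t))\<^sup>2)"
      using V by (intro leading_coeff_defect[OF n(1) orth disc_alg_G G_0 C1_G, where H = H] R(1))
         (auto simp: full_wave_def)
    also have "\<dots> \<le> 2 * (4 * \<epsilon>\<^sup>2)" using R(2) by simp
    also have "\<dots> = (8 * C\<^sup>2) / real n ^ (2 * (k - 1))"
      by (simp add: \<epsilon>_def power_divide power_mult[symmetric] mult.commute)
    finally show ?thesis .
  qed
  then show ?thesis using C by (intro exI[of _ "8 * C\<^sup>2"] exI[of _ n0] conjI) auto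
qed

end

section \<open>The potential\<close>

lemma C_lip_circle_derivatives:
  assumes "C_lip_circle K V"
  shows "j < K \<Longrightarrow> ((deriv ^^ j) V has_real_derivative (deriv ^^ Suc j) V x) (at x)"
    and "j \<le> K \<Longrightarrow> continuous_on UNIV ((deriv ^^ j) V)"
    and "j \<le> K \<Longrightarrow> periodic_2pi ((deriv ^^ j) V)"
proof -
  have der: "((deriv ^^ j) V has_real_derivative (deriv ^^ Suc j) V x) (at x)" if "j < K" for j x
    using assms that unfolding C_lip_circle_def
    by (simp add: DERIV_deriv_iff_real_differentiable)
  then show "j < K \<Longrightarrow> ((deriv ^^ j) V has_real_derivative (deriv ^^ Suc j) V x) (at x)" .
  show "continuous_on UNIV ((deriv ^^ j) V)" if "j \<le> K"
  proof (cases "j = K")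
    case True
    then show ?thesis using assms unfolding C_lip_circle_def by (auto intro: lipschitz_on_continuous_on)
  next
    case False
    then show ?thesis using der[of j] that
      by (intro continuous_at_imp_continuous_on) (auto intro: DERIV_isCont)
  qed
  show "j \<le> K \<Longrightarrow> periodic_2pi ((deriv ^^ j) V)"
  proof (induction j)
    case 0 then show ?case using assms unfolding C_lip_circle_def by simp
  next
    case (Suc j)
    then have j: "j < K" and per: "(\<lambda>x. (deriv ^^ j) V (x + 2 * pi)) = (deriv ^^ j) V"
      by (auto simp: periodic_2pi_def)
    show ?case unfolding periodic_2pi_def
    proof
      fix x
      \<comment> \<open>The translate is the same function by the induction hypothesis, so
        uniqueness of derivatives transfers periodicity to the next order.\<close>
      have "((\<lambda>x. (deriv ^^ j) V (x + 2 * pi)) has_real_derivative (deriv ^^ Suc j) V (x + 2 * pi)) (at x)"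
        using der[OF j, of "x + 2 * pi"] DERIV_shift by blast
      then show "(deriv ^^ Suc j) V (x + 2 * pi) = (deriv ^^ Suc j) V x"
        unfolding per using der[OF j] by (rule DERIV_unique)
    qed
  qed
qed

lemma fcoeff_iterated_deriv:
  assumes "C_lip_circle K V" "j \<le> K"
  shows "fcoeff (\<lambda>t. of_real ((deriv ^^ j) V t)) m = (\<i> * of_int m) ^ j * fcoeff (\<lambda>t. of_real (V t)) m"
  using assms(2)
proof (induction j)
  case (Suc j)
  have "fcoeff (\<lambda>t. complex_of_real ((deriv ^^ Suc j) V t)) m = \<i> * of_int m * fcoeff (\<lambda>t. of_real ((deriv ^^ j) V t)) m"
  proof (rule fcoeff_deriv)
    show "periodic_2pi (\<lambda>t. complex_of_real ((deriv ^^ j) V t))"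
      using C_lip_circle_derivatives(3)[OF assms(1), of j] Suc.prems by (simp add: periodic_2pi_def)
    show "((\<lambda>t. complex_of_real ((deriv ^^ j) V t)) has_vector_derivative of_real ((deriv ^^ Suc j) V t)) (at t)" for t
      using C_lip_circle_derivatives(1)[OF assms(1), of j t] Suc.prems
      by (intro has_vector_derivative_of_real) simp
  qed
  with Suc show ?case by (simp add: mult_ac)
qed simp

text \<open>The last derivative is merely Lipschitz, so Bessel's inequality is applied to its
  difference quotients, which are bounded by \<open>L\<close>. Letting the step \<open>h\<close>
  tend to 0 in the finite sum turns the multiplier \<open>(cis (real j * h) - 1) / h\<close> into
  one of modulus \<open>j\<close>.\<close>

lemma fcoeff_lipschitz_bound:
  assumes V: "C_lip_circle K V" and L: "L-lipschitz_on UNIV ((deriv ^^ K) V)"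
  shows "(\<Sum>j\<le>J. (real j ^ Suc K * cmod (fcoeff (\<lambda>t. of_real (V t)) (int j)))\<^sup>2) \<le> L\<^sup>2"
proof -
  define W where "W = (\<lambda>t. complex_of_real ((deriv ^^ K) V t))"
  define c where "c = (\<lambda>j. cmod (fcoeff W (int j)))"
  have contW: "continuous_on UNIV W" and perW: "periodic_2pi W"
    using C_lip_circle_derivatives(2,3)[OF V order_refl]
    by (auto simp: W_def periodic_2pi_def intro!: continuous_intros)
  have contW': "continuous_on A (\<lambda>t. W (t + h))" "continuous_on A W" for A h
    by (auto intro!: continuous_on_compose2[OF contW] continuous_intros intro: continuous_on_subset[OF contW])
  have fin: "(\<Sum>j\<le>J. (cmod ((cis (real j * h) - cis (real j * 0)) / of_real h) * c j)\<^sup>2) \<le> L\<^sup>2" if h: "h > 0" for h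
  proof -
    have co: "fcoeff (\<lambda>t. W (t + h) - W t) (int j) = (cis (real j * h) - 1) * fcoeff W (int j)" for j
    proof -
      have "fcoeff (\<lambda>t. W (t + h) - W t) (int j) = fcoeff (\<lambda>t. W (t + h)) (int j) - fcoeff W (int j)"
        unfolding fcoeff_def left_diff_distrib
        by (subst mean_diff, (intro continuous_intros contW')+, rule refl)
      then show ?thesis by (simp add: fcoeff_shift[OF contW perW] algebra_simps)
    qed
    have "(\<Sum>j\<le>J. (cmod (cis (real j * h) - 1) * c j)\<^sup>2) = (\<Sum>i\<in>int ` {..J}. (cmod (fcoeff (\<lambda>t. W (t + h) - W t) i))\<^sup>2)"
      by (subst sum.reindex) (auto simp: co norm_mult c_def)
    also have "\<dots> \<le> mean (\<lambda>t. (cmod (W (t + h) - W t))\<^sup>2)"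
      by (rule bessel) (auto intro!: continuous_intros contW')
    also have "\<dots> \<le> mean (\<lambda>t. (L * h)\<^sup>2)"
    proof (rule mean_mono)
      fix t
      have "cmod (W (t + h) - W t) = dist ((deriv ^^ K) V (t + h)) ((deriv ^^ K) V t)"
        by (simp add: W_def dist_real_def flip: of_real_diff)
      also have "\<dots> \<le> L * h" using lipschitz_onD[OF L, of "t + h" t] h by (simp add: dist_real_def)
      finally show "(cmod (W (t + h) - W t))\<^sup>2 \<le> (L * h)\<^sup>2" by (intro power_mono) auto
    qed (intro continuous_intros contW')+
    finally have "(\<Sum>j\<le>J. (cmod (cis (real j * h) - 1) * c j)\<^sup>2) / h\<^sup>2 \<le> (L * h)\<^sup>2 / h\<^sup>2"
      by (intro divide_right_mono) auto
    also have "(L * h)\<^sup>2 / h\<^sup>2 = L\<^sup>2" using h by (simp add: power_mult_distrib)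
    also have "(\<Sum>j\<le>J. (cmod (cis (real j * h) - 1) * c j)\<^sup>2) / h\<^sup>2
        = (\<Sum>j\<le>J. (cmod ((cis (real j * h) - cis (real j * 0)) / of_real h) * c j)\<^sup>2)"
      using h by (simp add: sum_divide_distrib norm_divide power_mult_distrib power_divide)
    finally show ?thesis .
  qed
  have lim: "((\<lambda>h. (cis (real j * h) - cis (real j * 0)) / of_real h) \<longlongrightarrow> \<i> * of_real (real j) * cis (real j * 0)) (at_right 0)" for j
    by (rule filterlim_mono[OF has_vector_derivative_quotient[OF has_vector_derivative_cis_mult[of "real j" 0 UNIV]]])
       (auto simp: at_le)
  have "(\<Sum>j\<le>J. (cmod (\<i> * of_real (real j) * cis (real j * 0)) * c j)\<^sup>2) \<le> L\<^sup>2"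
  proof (rule tendsto_upperbound)
    show "((\<lambda>h. \<Sum>j\<le>J. (cmod ((cis (real j * h) - cis (real j * 0)) / of_real h) * c j)\<^sup>2)
        \<longlongrightarrow> (\<Sum>j\<le>J. (cmod (\<i> * of_real (real j) * cis (real j * 0)) * c j)\<^sup>2)) (at_right 0)"
      by (intro tendsto_sum tendsto_power tendsto_mult tendsto_norm tendsto_const lim)
    show "\<forall>\<^sub>F h in at_right 0. (\<Sum>j\<le>J. (cmod ((cis (real j * h) - cis (real j * 0)) / of_real h) * c j)\<^sup>2) \<le> L\<^sup>2"
      using fin by (auto simp: eventually_at_right_field intro!: exI[of _ 1])
  qed simp
  moreover have "cmod (\<i> * of_real (real j) * cis (real j * 0)) * c j = real j ^ Suc K * cmod (fcoeff (\<lambda>t. of_real (V t)) (int j))" for j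
    unfolding c_def W_def fcoeff_iterated_deriv[OF V order_refl] by (simp add: norm_mult norm_power)
  ultimately show ?thesis by simp
qed

lemma fourier_coeff_fcoeff: "fourier_coeff V j = fcoeff (\<lambda>t. of_real (V t)) j"
  by (simp add: fourier_coeff_def fcoeff_def mean_def cis_conv_exp scaleR_conv_of_real mult.assoc)

lemma fcoeff_of_real_minus:
  assumes "cont_circle V"
  shows "fcoeff (\<lambda>t. complex_of_real (V t)) (- j) = cnj (fcoeff (\<lambda>t. of_real (V t)) j)"
proof -
  have "cont_circle (\<lambda>t. complex_of_real (V t) * cis (- (of_int j * t)))"
    by (intro continuous_intros assms)
  from mean_cnj[OF this] show ?thesis by (simp add: fcoeff_def cis_cnj)
qed

locale smooth_potential =
  fixes V :: "real \<Rightarrow> real" and k :: nat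
  assumes k: "k \<ge> 2" and V: "C_lip_circle (k - 1) V"
begin

definition W :: "real \<Rightarrow> complex" where "W t = of_real (V t)"

text \<open>Index 0 is cleared because the mean of \<open>V\<close> is kept apart and
  \<open>G\<close> has to vanish at the origin.\<close>

definition a :: "nat \<Rightarrow> complex" where "a j = (if j = 0 then 0 else fcoeff W (int j))"

lemma continuous_V: "continuous_on S V"
  using C_lip_circle_derivatives(2)[OF V, of 0] by (auto intro: continuous_on_subset)

lemma a_weighted_bound:
  obtains B where "\<And>J. (\<Sum>j\<le>J. (real j ^ k * cmod (a j))\<^sup>2) \<le> B"
proof -
  obtain L where L: "L-lipschitz_on UNIV ((deriv ^^ (k - 1)) V)"
    using V unfolding C_lip_circle_def by blast
  have k': "Suc (k - 1) = k" using k by simp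
  have "(\<Sum>j\<le>J. (real j ^ k * cmod (a j))\<^sup>2) \<le> L\<^sup>2" for J
  proof (rule order_trans[OF sum_mono])
    show "(\<Sum>j\<le>J. (real j ^ k * cmod (fcoeff (\<lambda>t. of_real (V t)) (int j)))\<^sup>2) \<le> L\<^sup>2"
      using fcoeff_lipschitz_bound[OF V L, of J] unfolding k' .
  qed (use k in \<open>auto simp: a_def W_def[abs_def]\<close>)
  then show ?thesis using that by blast
qed

text \<open>As \<open>k \<ge> 2\<close>, the bound for \<open>j ^ k * cmod (a j)\<close> also covers
  \<open>j * (j * cmod (a j))\<close>, so square summability with one spare power of
  \<open>j\<close> gives summability.\<close>

lemma summable_ja: "summable (\<lambda>j. real j * cmod (a j))"
proof (rule summable_of_weighted_squares)
  obtain B where B: "\<And>J. (\<Sum>j\<le>J. (real j ^ k * cmod (a j))\<^sup>2) \<le> B"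
    by (rule a_weighted_bound) blast
  have le: "(real j * (real j * cmod (a j)))\<^sup>2 \<le> (real j ^ k * cmod (a j))\<^sup>2" for j
  proof (cases "j = 0")
    case False
    then have "real j ^ 2 \<le> real j ^ k" using k by (intro power_increasing) auto
    then have "real j ^ 2 * cmod (a j) \<le> real j ^ k * cmod (a j)" by (rule mult_right_mono) simp
    then show ?thesis by (intro power_mono) (auto simp: power2_eq_square mult.assoc)
  qed simp
  show "summable (\<lambda>j. (real j * (real j * cmod (a j)))\<^sup>2)"
  proof (rule summableI_nonneg_bounded)
    fix n
    have "(\<Sum>j<n. (real j * (real j * cmod (a j)))\<^sup>2) \<le> (\<Sum>j\<le>n. (real j ^ k * cmod (a j))\<^sup>2)"
      by (rule order_trans[OF sum_mono[OF le] sum_mono2]) auto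
    with B[of n] show "(\<Sum>j<n. (real j * (real j * cmod (a j)))\<^sup>2) \<le> B" by linarith
  qed simp
qed simp

sublocale circle_series a "\<Sum>j. real j * cmod (a j)"
proof
  show "(\<Sum>j\<le>J. real j * cmod (a j)) \<le> (\<Sum>j. real j * cmod (a j))" for J
    by (rule sum_le_suminf[OF summable_ja]) auto
qed (simp add: a_def)

lemma W_series:
  "summable (\<lambda>j. fcoeff W (int j) * cis (real j * t))"
  "G (cis t) = (\<Sum>j. fcoeff W (int (Suc j)) * cis (real (Suc j) * t))"
proof -
  have s: "summable (\<lambda>j. a j * cis (real j * t))"
    by (rule summable_norm_cancel) (simp add: norm_mult summable_\<alpha>)
  have "summable (\<lambda>j. a (Suc j) * cis (real (Suc j) * t))"
    using s summable_Suc_iff[of "\<lambda>j. a j * cis (real j * t)"] by blast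
  then have "summable (\<lambda>j. fcoeff W (int (Suc j)) * cis (real (Suc j) * t))"
    by (simp add: a_def)
  then show "summable (\<lambda>j. fcoeff W (int j) * cis (real j * t))"
    using summable_Suc_iff[of "\<lambda>j. fcoeff W (int j) * cis (real j * t)"] by blast
  show "G (cis t) = (\<Sum>j. fcoeff W (int (Suc j)) * cis (real (Suc j) * t))"
    using suminf_split_head[OF s] unfolding G_cis by (simp add: a_def)
qed

text \<open>\<open>V\<close> is real, so its coefficients of opposite index are conjugate, as are
  the powers of \<open>cis t\<close> and its inverse.\<close>

lemma N_fun_cis: "N_fun V (cis t) = cnj (G (cis t))"
proof -
  let ?f = "\<lambda>j. fcoeff W (int (Suc j)) * cis (real (Suc j) * t)"
  have s: "summable ?f"
    using W_series(1)[of t] summable_Suc_iff[of "\<lambda>j. fcoeff W (int j) * cis (real j * t)"] by blast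
  have "cnj (G (cis t)) = (\<Sum>j. cnj (?f j))"
    unfolding W_series(2) using bounded_linear.suminf[OF bounded_linear_cnj s] by simp
  also have "\<dots> = N_fun V (cis t)"
    unfolding N_fun_def
  proof (rule suminf_cong)
    fix j
    have "cis t powi (- int (Suc j)) = inverse (cis t ^ Suc j)"
      by (simp add: power_int_minus flip: power_int_of_nat del: of_nat_Suc power_Suc)
    also have "\<dots> = cis (- (real (Suc j) * t))"
      unfolding Complex.DeMoivre by simp
    finally have "cis t powi (- int (Suc j)) = cnj (cis (real (Suc j) * t))"
      by (simp only: cis_cnj)
    moreover have "fourier_coeff V (- int (Suc j)) = cnj (fcoeff W (int (Suc j)))"
      unfolding fourier_coeff_fcoeff W_def[abs_def] by (rule fcoeff_of_real_minus[OF continuous_V])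
    ultimately show "cnj (?f j) = fourier_coeff V (- int (Suc j)) * cis t powi (- int (Suc j))"
      by simp
  qed
  finally show ?thesis by simp
qed

lemma kappa_eq: "kappa V t = t - 2 * Im (G (cis t))"
  unfolding kappa_def Omega_def by (simp add: N_fun_cis flip: cis_conv_exp)

text \<open>The Fourier series of \<open>V\<close> consists of its mean, the positive frequencies
  \<open>G\<close> and the negative frequencies, which are the conjugate of
  \<open>G\<close>.\<close>

lemma V_eq: "V t = Re (fourier_coeff V 0) + 2 * Re (G (cis t))"
proof -
  have "C1 W"
    unfolding C1_def W_def[abs_def]
  proof (intro exI conjI allI)
    have "(V has_real_derivative (deriv ^^ Suc 0) V t) (at t)" for t
      using C_lip_circle_derivatives(1)[OF V, of 0] k by simp
    then show "((\<lambda>t. complex_of_real (V t)) has_vector_derivative of_real ((deriv ^^ Suc 0) V t)) (at t)" for t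
      by (intro has_vector_derivative_of_real)
    show "continuous_on UNIV (\<lambda>t. complex_of_real ((deriv ^^ Suc 0) V t))"
      using C_lip_circle_derivatives(2)[OF V, of "Suc 0"] k by (intro continuous_intros) simp
  qed
  moreover have "periodic_2pi W"
    using V unfolding C_lip_circle_def periodic_2pi_def W_def by simp
  ultimately have W: "W t = (\<Sum>j. fcoeff W (int j) * cis (real j * t)) + (\<Sum>j. fcoeff W (- int (Suc j)) * cis (- (real (Suc j) * t)))"
    by (rule C1_wiener(3))
  have neg: "fcoeff W (- int (Suc j)) = fourier_coeff V (- int (Suc j))" for j
    unfolding fourier_coeff_fcoeff W_def[abs_def] ..
  have pw: "cis (- (real (Suc j) * t)) = cis t powi (- int (Suc j))" for j
  proof -
    have "cis t powi (- int (Suc j)) = inverse (cis t ^ Suc j)"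
      by (simp add: power_int_minus flip: power_int_of_nat del: of_nat_Suc power_Suc)
    then show ?thesis unfolding Complex.DeMoivre by simp
  qed
  have "(\<Sum>j. fcoeff W (int j) * cis (real j * t)) = G (cis t) + fcoeff W 0"
    using suminf_split_head[OF W_series(1)[of t]] W_series(2)[of t] by simp
  moreover have "(\<Sum>j. fcoeff W (- int (Suc j)) * cis (- (real (Suc j) * t))) = cnj (G (cis t))"
    unfolding neg pw N_fun_cis[symmetric] N_fun_def ..
  moreover have "fcoeff W 0 = fourier_coeff V 0" by (simp add: fourier_coeff_fcoeff W_def[abs_def])
  ultimately have "W t = G (cis t) + fourier_coeff V 0 + cnj (G (cis t))" using W by simp
  then have "Re (W t) = Re (G (cis t) + fourier_coeff V 0 + cnj (G (cis t)))" by simp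
  then show ?thesis by (simp add: W_def)
qed

text \<open>The derivative of \<open>kappa V\<close> is continuous, periodic and positive, so it has
  a positive minimum \<delta>. The differentiated series converges uniformly; an error below
  \<open>\<delta> / 4\<close> in its partial sum changes the slope by less than
  \<open>\<delta> / 2\<close>.\<close>

lemma kappa_deriv_lower_bound:
  assumes pos: "\<forall>\<theta>. \<exists>d>0. (kappa V has_real_derivative d) (at \<theta>)"
  obtains \<delta> l0 where "\<delta> > 0"
    "\<And>N t. N \<ge> 2 ^ l0 \<Longrightarrow> \<delta> / 2 \<le> 1 - 2 * (\<Sum>j\<le>N. real j * Re (a j * cis (real j * t)))"
proof -
  define D where "D = (\<lambda>t. \<Sum>j. a j * (\<i> * of_real (real j) * cis (real j * t)))"
  define f where "f = (\<lambda>t. 1 - 2 * Im (D t))"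
  have contD: "continuous_on UNIV D" unfolding D_def by (rule G_deriv(2))
  have fpos: "f t > 0" for t
  proof -
    have "((\<lambda>t. G (cis t)) has_vector_derivative D t) (at t)" unfolding D_def by (rule G_deriv(1))
    then have "((\<lambda>t. Im (G (cis t))) has_real_derivative Im (D t)) (at t)"
      unfolding has_real_derivative_iff_has_vector_derivative by (rule bounded_linear.has_vector_derivative[OF bounded_linear_Im])
    from DERIV_diff[OF DERIV_ident DERIV_cmult[OF this, of 2]]
    have "(kappa V has_real_derivative f t) (at t)"
      unfolding kappa_eq[abs_def] f_def .
    with pos show ?thesis using DERIV_unique by blast
  qed
  have "cont_circle f" unfolding f_def
    by (intro continuous_intros continuous_on_subset[OF contD] subset_UNIV)
  then obtain t0 where t0: "\<And>t. t \<in> {-pi..pi} \<Longrightarrow> f t0 \<le> f t"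
    using continuous_attains_inf[of "{-pi..pi}" f] compact_Icc pi_ge_zero by fastforce
  have perf: "periodic_2pi f"
    unfolding periodic_2pi_def
  proof
    fix t
    have "cis (real j * (t + 2 * pi)) = cis (real j * t)" for j
      unfolding Complex.DeMoivre[symmetric] by (simp add: cis_mult[symmetric])
    then show "f (t + 2 * pi) = f t" unfolding f_def D_def by simp
  qed
  define \<delta> where "\<delta> = f t0"
  have \<delta>: "\<delta> > 0" using fpos by (simp add: \<delta>_def)
  have f\<delta>: "\<delta> \<le> f t" for t
  proof -
    define m where "m = \<lfloor>(t + pi) / (2 * pi)\<rfloor>"
    have m: "of_int m \<le> (t + pi) / (2 * pi)" "(t + pi) / (2 * pi) \<le> of_int m + 1"
      unfolding m_def by linarith+
    define s where "s = t + 2 * pi * of_int (- m)"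
    have "s = 2 * pi * ((t + pi) / (2 * pi) - of_int m) - pi"
      by (simp add: s_def right_diff_distrib)
    moreover have "0 \<le> 2 * pi * ((t + pi) / (2 * pi) - of_int m)"
      using m by (intro mult_nonneg_nonneg) auto
    moreover have "2 * pi * ((t + pi) / (2 * pi) - of_int m) \<le> 2 * pi * 1"
      using m by (intro mult_left_mono) auto
    ultimately have "s \<in> {-pi..pi}" by simp
    then have "\<delta> \<le> f s" unfolding \<delta>_def by (rule t0)
    also have "f s = f t" unfolding s_def by (rule periodic_shift_int[OF perf])
    finally show ?thesis .
  qed
  have "uniform_limit UNIV (\<lambda>n t. \<Sum>j<n. a j * (\<i> * of_real (real j) * cis (real j * t))) D sequentially"
    unfolding D_def by (rule Weierstrass_m_test[OF _ summable_ja]) (simp add: norm_mult mult.commute)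
  moreover have "\<delta> / 4 > 0" using \<delta> by simp
  ultimately obtain M where M: "\<And>n t. n \<ge> M \<Longrightarrow> dist (\<Sum>j<n. a j * (\<i> * of_real (real j) * cis (real j * t))) (D t) < \<delta> / 4"
    unfolding uniform_limit_iff eventually_sequentially by blast
  have "\<delta> / 2 \<le> 1 - 2 * (\<Sum>j\<le>N. real j * Re (a j * cis (real j * t)))" if N: "N \<ge> 2 ^ M" for N t
  proof -
    let ?P = "\<Sum>j<Suc N. a j * (\<i> * of_real (real j) * cis (real j * t))"
    \<comment> \<open>The threshold \<open>M\<close> itself can serve as the dyadic exponent
      \<open>l0\<close>.\<close>
    have "M < 2 ^ M" by (rule less_exp)
    then have "M \<le> Suc N" using N by linarith
    from M[OF this, of t] have "\<bar>Im ?P - Im (D t)\<bar> < \<delta> / 4"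
      using abs_Im_le_cmod[of "?P - D t"] unfolding dist_norm minus_complex.sel by linarith
    moreover have "Im ?P = (\<Sum>j\<le>N. real j * Re (a j * cis (real j * t)))"
      unfolding Im_sum lessThan_Suc_atMost by (rule sum.cong) (auto simp: algebra_simps)
    ultimately show ?thesis using f\<delta>[of t] unfolding f_def by linarith
  qed
  then show ?thesis using that \<delta> by blast
qed

end

section \<open>The asymptotics of the leading coefficient\<close>

theorem theorem4p7:
  fixes V :: "real \<Rightarrow> real" and k :: nat
  assumes "k \<ge> 2"
    and "C_lip_circle (k - 1) V"
    and "\<forall>\<theta>. \<exists>d > 0. (kappa V has_real_derivative d) (at \<theta>)"
  shows "\<exists>K > 0. \<exists>n0. \<forall>n \<ge> n0. \<forall>p.
           orthonormal_polys (\<lambda>\<theta>. exp (- real n * V \<theta>)) p \<longrightarrow>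
           \<bar>(Re (lead_coeff (p (n - 1))))\<^sup>2 * exp (- real n * Re (fourier_coeff V 0)) - 1\<bar>
             \<le> K * ln (real n) / real n ^ (2 * (k - 1))"
proof -
  interpret smooth_potential V k
    using assms by unfold_locales
  obtain \<delta> l0 where \<delta>: "\<delta> > 0"
    "\<And>N t. N \<ge> 2 ^ l0 \<Longrightarrow> \<delta> / 2 \<le> 1 - 2 * (\<Sum>j\<le>N. real j * Re (a j * cis (real j * t)))"
    using kappa_deriv_lower_bound[OF assms(3)] by blast
  obtain B where B: "\<And>J. (\<Sum>j\<le>J. (real j ^ k * cmod (a j))\<^sup>2) \<le> B"
    using a_weighted_bound by blast
  interpret circle_phase a "\<Sum>j. real j * cmod (a j)" k l0 \<delta> B
    using assms(1) \<delta> B by unfold_locales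
  obtain K n0 where K: "K > 0" and bd: "\<And>n p. n \<ge> n0 \<Longrightarrow> orthonormal_polys (\<lambda>\<theta>. exp (- real n * V \<theta>)) p \<Longrightarrow>
     \<bar>(Re (lead_coeff (p (n - 1))))\<^sup>2 * exp (- real n * Re (fourier_coeff V 0)) - 1\<bar> \<le> K / real n ^ (2 * (k - 1))"
    using leading_coeff_asymptotics V_eq by meson
  show ?thesis
  \<comment> \<open>The bound obtained has no logarithm. From \<open>n \<ge> 3\<close> on,
    \<open>n\<close> exceeds \<open>exp 1\<close>, so the factor \<open>ln (real n)\<close> is at
    least 1 and may be inserted.\<close>
  proof (intro exI[of _ K] exI[of _ "max 3 n0"] conjI allI impI K)
    fix n p assume n: "max 3 n0 \<le> n" and orth: "orthonormal_polys (\<lambda>\<theta>. exp (- real n * V \<theta>)) p"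
    have "exp 1 \<le> real n" using n exp_le by linarith
    then have "1 \<le> ln (real n)" using n by (subst ln_ge_iff) auto
    then have "K / real n ^ (2 * (k - 1)) \<le> K * ln (real n) / real n ^ (2 * (k - 1))"
      using K by (intro divide_right_mono) auto
    with bd[of n p] n orth
    show "\<bar>(Re (lead_coeff (p (n - 1))))\<^sup>2 * exp (- real n * Re (fourier_coeff V 0)) - 1\<bar>
             \<le> K * ln (real n) / real n ^ (2 * (k - 1))"
      by fastforce
  qed
qed

end
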